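(* Let $L$ and $L'$ be $\mathcal L_1$-spaces, let $Y,Y',Z$ be Banach spaces, and let $0 \to Y \to L \to Z \to 0$ and $0\to Y' \to L' \to Z \to 0$ be two exact sequences of Banach spaces and bounded linear operators (with the same quotient space $Z$). Then $Y$ has the BAP if and only if $Y'$ has the BAP.
   Context: A Banach space $X$ has the $\lambda$-BAP ($\lambda\ge 1$) if for each finite dimensional subspace $F\subset X$ there is a finite rank bounded operator $T:X\to X$ with $\|T\|\le \lambda$ and $T(f)=f$ for each $f\in F$. $X$ has the BAP (Bounded Approximation Property) if it has the $\lambda$-BAP for some $\lambda$. A Banach space $L$ is a $\mathcal L_1$-space if there is $\mu\ge 1$ such that every finite dimensional subspace of $L$ is contained in a finite dimensional subspace $G$ of $L$ whose Banach–Mazur distance to $\ell_1^{\dim G}$ is at most $\mu$. An exact sequence $0\to Y\to X\to Z\to 0$ of Banach spaces is a diagram of bounded linear operators in which the kernel of each arrow coincides with the image of the preceding one. *)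

theory Defs
  imports "HOL-Analysis.Analysis"
begin

text \<open>
  Real scalars throughout. A Banach space is a type of class \<^class>\<open>banach\<close>; properties of such a
  space are predicates on its type. The spaces \<open>\<ell>\<^sub>1\<^sup>n\<close>, whose dimension has to be quantified over
  inside a formula, are realised as subspaces of the type of absolutely summable real sequences.
\<close>

lemma summable_abs_add:
  fixes x y :: "nat \<Rightarrow> real"
  assumes "summable (\<lambda>i. \<bar>x i\<bar>)" "summable (\<lambda>i. \<bar>y i\<bar>)"
  shows "summable (\<lambda>i. \<bar>x i + y i\<bar>)"
  by (rule summable_comparison_test'[OF summable_add[OF assms], where N = 0]) auto

lemma summable_abs_diff:
  fixes x y :: "nat \<Rightarrow> real"
  assumes "summable (\<lambda>i. \<bar>x i\<bar>)" "summable (\<lambda>i. \<bar>y i\<bar>)"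
  shows "summable (\<lambda>i. \<bar>x i - y i\<bar>)"
  by (rule summable_comparison_test'[OF summable_add[OF assms], where N = 0]) auto

typedef ell1 = "{x :: nat \<Rightarrow> real. summable (\<lambda>i. \<bar>x i\<bar>)}"
  morphisms coord Abs_ell1
  by (rule exI[of _ "\<lambda>_. 0"]) simp

setup_lifting type_definition_ell1

instantiation ell1 :: real_normed_vector
begin

lift_definition zero_ell1 :: ell1 is "\<lambda>_. 0" by simp

lift_definition plus_ell1 :: "ell1 \<Rightarrow> ell1 \<Rightarrow> ell1" is "\<lambda>x y i. x i + y i"
  by (rule summable_abs_add)

lift_definition uminus_ell1 :: "ell1 \<Rightarrow> ell1" is "\<lambda>x i. - x i" by simp

lift_definition minus_ell1 :: "ell1 \<Rightarrow> ell1 \<Rightarrow> ell1" is "\<lambda>x y i. x i - y i"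
  by (rule summable_abs_diff)

lift_definition scaleR_ell1 :: "real \<Rightarrow> ell1 \<Rightarrow> ell1" is "\<lambda>c x i. c * x i"
  by (simp add: abs_mult summable_mult)

lift_definition norm_ell1 :: "ell1 \<Rightarrow> real" is "\<lambda>x. \<Sum>i. \<bar>x i\<bar>" .

definition dist_ell1 :: "ell1 \<Rightarrow> ell1 \<Rightarrow> real"
  where "dist_ell1 x y = norm (x - y)"

definition sgn_ell1 :: "ell1 \<Rightarrow> ell1"
  where "sgn_ell1 x = inverse (norm x) *\<^sub>R x"

definition uniformity_ell1 :: "(ell1 \<times> ell1) filter"
  where "uniformity_ell1 = (INF e\<in>{0<..}. principal {(x, y). dist x y < e})"

definition open_ell1 :: "ell1 set \<Rightarrow> bool"
  where "open_ell1 U = (\<forall>x\<in>U. \<forall>\<^sub>F (x', y) in uniformity. x' = x \<longrightarrow> y \<in> U)"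

instance
proof
  fix x y z :: ell1 and a b :: real
  show "x + y + z = x + (y + z)" by transfer (simp add: add.assoc)
  show "x + y = y + x" by transfer (simp add: add.commute)
  show "0 + x = x" by transfer simp
  show "- x + x = 0" by transfer simp
  show "x - y = x + - y" by transfer simp
  show "a *\<^sub>R (x + y) = a *\<^sub>R x + a *\<^sub>R y" by transfer (simp add: algebra_simps)
  show "(a + b) *\<^sub>R x = a *\<^sub>R x + b *\<^sub>R x" by transfer (simp add: algebra_simps)
  show "a *\<^sub>R b *\<^sub>R x = (a * b) *\<^sub>R x" by transfer (simp add: mult.assoc)
  show "1 *\<^sub>R x = x" by transfer simp
  show "dist x y = norm (x - y)" by (rule dist_ell1_def)
  show "sgn x = inverse (norm x) *\<^sub>R x" by (rule sgn_ell1_def)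
  show "uniformity = (INF e\<in>{0<..}. principal {(x, y :: ell1). dist x y < e})"
    by (rule uniformity_ell1_def)
  show "open U = (\<forall>x\<in>U. \<forall>\<^sub>F (x', y) in uniformity. x' = x \<longrightarrow> y \<in> U)" for U :: "ell1 set"
    by (rule open_ell1_def)
  show "norm x = 0 \<longleftrightarrow> x = 0"
    by transfer (auto simp: suminf_eq_zero_iff fun_eq_iff)
  show "norm (x + y) \<le> norm x + norm y"
  proof transfer
    fix x y :: "nat \<Rightarrow> real"
    assume s: "summable (\<lambda>i. \<bar>x i\<bar>)" "summable (\<lambda>i. \<bar>y i\<bar>)"
    have "(\<Sum>i. \<bar>x i + y i\<bar>) \<le> (\<Sum>i. \<bar>x i\<bar> + \<bar>y i\<bar>)"
      by (intro suminf_le summable_add summable_abs_add s) auto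
    then show "(\<Sum>i. \<bar>x i + y i\<bar>) \<le> (\<Sum>i. \<bar>x i\<bar>) + (\<Sum>i. \<bar>y i\<bar>)"
      by (simp add: suminf_add[OF s])
  qed
  show "norm (a *\<^sub>R x) = \<bar>a\<bar> * norm x"
    by transfer (simp add: abs_mult suminf_mult)
qed

end

definition ell1_n :: "nat \<Rightarrow> ell1 set"
  where "ell1_n n = {x. \<forall>i\<ge>n. coord x i = 0}"

definition finite_dim_subspace :: "'a::real_vector set \<Rightarrow> bool"
  where "finite_dim_subspace F \<longleftrightarrow> (\<exists>B. finite B \<and> F = span B)"

definition bounded_linear_on ::
    "'a::real_normed_vector set \<Rightarrow> ('a \<Rightarrow> 'b::real_normed_vector) \<Rightarrow> bool"
  where "bounded_linear_on E T \<longleftrightarrow>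
    (\<forall>x\<in>E. \<forall>y\<in>E. T (x + y) = T x + T y) \<and>
    (\<forall>c. \<forall>x\<in>E. T (c *\<^sub>R x) = c *\<^sub>R T x) \<and>
    (\<exists>K. \<forall>x\<in>E. norm (T x) \<le> norm x * K)"

definition onorm_on ::
    "'a::real_normed_vector set \<Rightarrow> ('a \<Rightarrow> 'b::real_normed_vector) \<Rightarrow> real"
  where "onorm_on E T = (SUP x\<in>E. norm (T x) / norm x)"

definition isomorphism_on ::
    "'a::real_normed_vector set \<Rightarrow> 'b::real_normed_vector set \<Rightarrow> ('a \<Rightarrow> 'b) \<Rightarrow> bool"
  where "isomorphism_on E F T \<longleftrightarrow>
    bij_betw T E F \<and> bounded_linear_on E T \<and> bounded_linear_on F (inv_into E T)"

text \<open>Extended real values, so that non-isomorphic subspaces have distance \<open>\<infinity>\<close>.\<close>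

definition banach_mazur_dist ::
    "'a::real_normed_vector set \<Rightarrow> 'b::real_normed_vector set \<Rightarrow> ereal"
  where "banach_mazur_dist E F =
    (INF T \<in> {T. isomorphism_on E F T}. ereal (onorm_on E T * onorm_on F (inv_into E T)))"

definition script_L1_space :: "'a::banach itself \<Rightarrow> bool"
  where "script_L1_space _ \<longleftrightarrow>
    (\<exists>\<mu>::real. \<mu> \<ge> 1 \<and>
      (\<forall>F :: 'a set. finite_dim_subspace F \<longrightarrow>
        (\<exists>G. finite_dim_subspace G \<and> F \<subseteq> G \<and> banach_mazur_dist G (ell1_n (dim G)) \<le> ereal \<mu>)))"

definition lambda_BAP :: "real \<Rightarrow> 'a::banach itself \<Rightarrow> bool"
  where "lambda_BAP l _ \<longleftrightarrow>
    l \<ge> 1 \<and>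
    (\<forall>F :: 'a set. finite_dim_subspace F \<longrightarrow>
      (\<exists>T :: 'a \<Rightarrow> 'a. bounded_linear T \<and> finite_dim_subspace (range T) \<and> onorm T \<le> l \<and>
        (\<forall>f\<in>F. T f = f)))"

definition has_BAP :: "'a::banach itself \<Rightarrow> bool"
  where "has_BAP X \<longleftrightarrow> (\<exists>l. lambda_BAP l X)"

text \<open>Exactness of \<open>0 \<rightarrow> Y \<rightarrow> X \<rightarrow> Z \<rightarrow> 0\<close> at \<open>Y\<close>, \<open>X\<close> and \<open>Z\<close>, in this order.\<close>

definition short_exact ::
    "('y::banach \<Rightarrow> 'x::banach) \<Rightarrow> ('x \<Rightarrow> 'z::banach) \<Rightarrow> bool"
  where "short_exact j q \<longleftrightarrow>
    bounded_linear j \<and> bounded_linear q \<and>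
    {y. j y = 0} = {0} \<and> {x. q x = 0} = range j \<and> range q = UNIV"

end

theory Submission imports Defs begin

text \<open>
  Write \<open>Y = ker q \<subseteq> L\<close> and \<open>Y' = ker q' \<subseteq> L'\<close>; the injections of the two sequences have bounded
  inverses on their ranges by the open mapping theorem. By symmetry it is enough to pass from the BAP
  of \<open>Y\<close> to that of \<open>Y'\<close>.

  Suppose first that there were global bounded lifts \<open>\<Phi> : L' \<rightarrow> L\<close> with \<open>q \<Phi> = q'\<close> and
  \<open>\<Psi> : L \<rightarrow> L'\<close> with \<open>q' \<Psi> = q\<close>. Then \<open>I - \<Psi> \<Phi>\<close> maps \<open>L'\<close> into \<open>Y'\<close>, and on \<open>Y'\<close> the identity is
  \<open>(I - \<Psi> \<Phi>) + \<Psi> \<Phi>\<close>, a sum of operators factoring through \<open>L'\<close> and through \<open>Y\<close>. Inserting a finite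
  rank operator \<open>S\<close> on \<open>L'\<close> in the first summand and a finite rank operator \<open>T\<close> on \<open>Y\<close> in the second
  gives \<open>(I - \<Psi> \<Phi>) S + \<Psi> T \<Phi>\<close>, which has finite rank, maps \<open>Y'\<close> to \<open>Y'\<close>, and fixes a finite dimensional
  \<open>F \<subseteq> Y'\<close> if \<open>S\<close> fixes \<open>F\<close> and \<open>T\<close> fixes \<open>\<Phi> F\<close>.

  In general such lifts exist only on finite dimensional subspaces, with a uniform bound: these
  subspaces are contained in copies of \<open>\<ell>\<^sub>1\<^sup>n\<close>, from which one lifts the unit vectors one at a time
  (\<open>l1_frame_lifting\<close>). This suffices wherever a lift is applied to the range of a finite rank operator.
  The exception is \<open>T \<Phi>\<close>, where the lift is applied first. There the local lifts are composed with \<open>T\<close>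
  and a limit is taken in the finite dimensional range of \<open>T\<close>
  (\<open>finite_rank_composite_with_lifts\<close>). Since the operator \<open>T\<close> is chosen for one particular lift \<open>\<Phi>\<close>
  on the range of \<open>S\<close>, the limit is taken of \<open>T (\<Phi> S + \<Phi>' (I - S))\<close> over local lifts \<open>\<Phi>'\<close>: on \<open>F\<close>,
  where \<open>S\<close> is the identity, this is \<open>T \<Phi>\<close> whatever \<open>\<Phi>'\<close> is.

  The other ingredient is that an \<open>\<L>\<^sub>1\<close>-space has the BAP, which supplies \<open>S\<close>
  (\<open>l1_frames_exact_approximation\<close>). In \<open>\<ell>\<^sub>1\<^sup>n\<close>, finitely many vectors are almost fixed by an averaging
  operator of norm one whose rank does not depend on \<open>n\<close> (\<open>l1_frame_coarsening\<close>). This uniformity allows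
  the functionals of these operators to converge along the finite dimensional subspaces; their vectors
  need not converge, but the limit functionals can be combined with the vectors from a single late stage.
\<close>

section \<open>Finite dimensional subspaces\<close>

text \<open>
  Maps given only on a subspace are replaced by maps that are linear on the whole space, with no
  bound claimed off the subspace. Linearity can then be used without membership conditions, and all
  norm estimates are kept relative to a subspace.
\<close>

lemma linear_extension_from_subspace:
  fixes T :: "'a::real_normed_vector \<Rightarrow> 'b::real_normed_vector"
  assumes "subspace E" "bounded_linear_on E T"
  obtains T' where "linear T'" "\<And>x. x \<in> E \<Longrightarrow> T' x = T x"
proof -
  have add: "T (x + y) = T x + T y" if "x \<in> E" "y \<in> E" for x y
    using assms(2) that unfolding bounded_linear_on_def by blast
  have scale: "T (c *\<^sub>R x) = c *\<^sub>R T x" if "x \<in> E" for c x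
    using assms(2) that unfolding bounded_linear_on_def by blast
  obtain B where B: "B \<subseteq> E" "independent B" "span B = E"
    using basis_exists[of E] span_subspace[OF _ _ assms(1)] by metis
  obtain T' where T': "linear T'" "\<And>x. x \<in> B \<Longrightarrow> T' x = T x"
    using linear_independent_extend[OF B(2), of T] by blast
  have "x \<in> E \<and> T' x = T x" if "x \<in> E" for x
    using that[folded B(3)]
  proof (induction rule: span_induct_alt)
    case base
    show ?case using scale[of 0 0] subspace_0[OF assms(1)] linear_0[OF T'(1)] by simp
  next
    case (step c x y)
    then show ?case
      using B(1) T' assms(1)
      by (auto simp: add scale linear_add linear_scale subspace_add subspace_scale)
  qed
  with T'(1) that show ?thesis by blast
qed

lemma finite_dim_subspace_span: "finite B \<Longrightarrow> finite_dim_subspace (span B)"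
  unfolding finite_dim_subspace_def by blast

lemma subspace_finite_dim: "finite_dim_subspace F \<Longrightarrow> subspace F"
  unfolding finite_dim_subspace_def by auto

lemma finite_dim_subspace_mono:
  fixes E :: "'a::real_vector set"
  assumes "finite_dim_subspace E" "subspace F" "F \<subseteq> E"
  shows "finite_dim_subspace F"
proof -
  obtain C where C: "finite C" "E = span C"
    using assms unfolding finite_dim_subspace_def by blast
  obtain B where B: "B \<subseteq> F" "independent B" "F \<subseteq> span B"
    using basis_exists[of F] by metis
  have "finite B"
    using independent_span_bound[OF C(1) B(2)] B(1) C(2) assms(3) by blast
  then show ?thesis
    unfolding finite_dim_subspace_def using B assms(2) span_subspace by metis
qed

lemma finite_dim_subspace_image:
  "linear f \<Longrightarrow> finite_dim_subspace F \<Longrightarrow> finite_dim_subspace (f ` F)"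
  unfolding finite_dim_subspace_def by (metis finite_imageI linear_span_image)

lemma finite_dim_subspace_sum:
  assumes "finite_dim_subspace F" "finite_dim_subspace G"
  shows "\<exists>E. finite_dim_subspace E \<and> F \<subseteq> E \<and> G \<subseteq> E"
proof -
  obtain B C where "finite B" "F = span B" "finite C" "G = span C"
    using assms unfolding finite_dim_subspace_def by blast
  then show ?thesis
    by (intro exI[of _ "span (B \<union> C)"]) (auto simp: finite_dim_subspace_span span_mono subsetD)
qed

section \<open>Factorisations through finite dimensional \<open>\<ell>\<^sub>1\<close>\<close>

text \<open>
  A factorisation of the identity of \<open>F\<close> through \<open>\<ell>\<^sub>1\<^sup>n\<close>: the map \<open>x \<mapsto> (a\<^sub>i x)\<close> has norm at
  most \<open>\<kappa>\<close> on \<open>F\<close>, and \<open>e\<^sub>i \<mapsto> g\<^sub>i\<close> has norm at most \<open>1\<close> because the unit ball of \<open>\<ell>\<^sub>1\<^sup>n\<close> is the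
  absolutely convex hull of the unit vectors. The vectors \<open>g\<^sub>i\<close> may lie outside \<open>F\<close>.
\<close>

definition l1_frame ::
    "real \<Rightarrow> 'a::real_normed_vector set \<Rightarrow> nat \<Rightarrow> (nat \<Rightarrow> 'a) \<Rightarrow> (nat \<Rightarrow> 'a \<Rightarrow> real) \<Rightarrow> bool"
  where "l1_frame \<kappa> F n g a \<longleftrightarrow>
    (\<forall>i. linear (a i)) \<and> (\<forall>i<n. norm (g i) \<le> 1) \<and>
    (\<forall>x\<in>F. (\<Sum>i<n. a i x *\<^sub>R g i) = x \<and> (\<Sum>i<n. \<bar>a i x\<bar>) \<le> \<kappa> * norm x)"

definition has_l1_frames :: "real \<Rightarrow> 'a::real_normed_vector itself \<Rightarrow> bool"
  where "has_l1_frames \<kappa> _ \<longleftrightarrow> 0 \<le> \<kappa> \<and>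
    (\<forall>F :: 'a set. finite_dim_subspace F \<longrightarrow> (\<exists>n g a. l1_frame \<kappa> F n g a))"

lemma onorm_on_ratio_bound:
  assumes "bounded_linear_on E T" "x \<in> E"
  shows "norm (T x) / norm x \<le> onorm_on E T"
proof -
  obtain K where K: "\<And>x. x \<in> E \<Longrightarrow> norm (T x) \<le> norm x * K"
    using assms(1) unfolding bounded_linear_on_def by blast
  have "norm (T y) / norm y \<le> \<bar>K\<bar>" if "y \<in> E" for y
    using K[OF that] by (cases "y = 0") (auto simp: field_simps intro: order_trans mult_left_mono)
  then have "bdd_above ((\<lambda>y. norm (T y) / norm y) ` E)"
    by (auto intro!: bdd_aboveI2)
  then show ?thesis
    unfolding onorm_on_def using assms(2) by (intro cSUP_upper)
qed

lemma onorm_on_bound: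
  assumes "bounded_linear_on E T" "x \<in> E"
  shows "norm (T x) \<le> onorm_on E T * norm x"
proof (cases "x = 0")
  case True
  have "T (0 *\<^sub>R x) = 0 *\<^sub>R T x"
    using assms unfolding bounded_linear_on_def by blast
  with True show ?thesis by simp
next
  case False
  then show ?thesis using onorm_on_ratio_bound[OF assms] by (simp add: field_simps)
qed

lemma onorm_on_nonneg:
  assumes "bounded_linear_on E T" "0 \<in> E"
  shows "0 \<le> onorm_on E T"
  using onorm_on_ratio_bound[OF assms] by simp

lift_definition unit_ell1 :: "nat \<Rightarrow> ell1" is "\<lambda>i k. if k = i then 1 else 0"
  by (rule summable_finite[of "{i}" for i]) auto

lemma norm_unit_ell1: "norm (unit_ell1 i) = 1"
proof transfer
  fix i :: nat
  have "(\<Sum>k. \<bar>if k = i then 1 else 0 :: real\<bar>) = (\<Sum>k\<in>{i}. \<bar>if k = i then 1 else 0\<bar>)"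
    by (rule suminf_finite) auto
  then show "(\<Sum>k. \<bar>if k = i then 1 else 0 :: real\<bar>) = 1" by simp
qed

lemma unit_ell1_in_ell1_n: "i < n \<Longrightarrow> unit_ell1 i \<in> ell1_n n"
  unfolding ell1_n_def by (auto simp: unit_ell1.rep_eq)

lemma subspace_ell1_n: "subspace (ell1_n n)"
  unfolding ell1_n_def subspace_def
  by (auto simp: zero_ell1.rep_eq plus_ell1.rep_eq scaleR_ell1.rep_eq)

lemma linear_coord: "linear (\<lambda>x. coord x i)"
  by (rule linearI) (auto simp: plus_ell1.rep_eq scaleR_ell1.rep_eq)

lemma norm_ell1_n:
  assumes "x \<in> ell1_n n"
  shows "norm x = (\<Sum>i<n. \<bar>coord x i\<bar>)"
  unfolding norm_ell1.rep_eq
  using assms unfolding ell1_n_def by (intro suminf_finite) auto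

lemma ell1_n_expansion:
  assumes "x \<in> ell1_n n"
  shows "(\<Sum>i<n. coord x i *\<^sub>R unit_ell1 i) = x"
proof -
  have "coord (\<Sum>i<n. coord x i *\<^sub>R unit_ell1 i) k = coord x k" for k
  proof -
    have "coord (\<Sum>i<n. coord x i *\<^sub>R unit_ell1 i) k = (\<Sum>i<n. coord x i * (if k = i then 1 else 0))"
      by (simp add: linear_sum[OF linear_coord] scaleR_ell1.rep_eq unit_ell1.rep_eq)
    also have "\<dots> = coord x k"
      using assms by (auto simp: ell1_n_def if_distrib cong: if_cong)
    finally show ?thesis .
  qed
  then show ?thesis by (metis coord_inject ext)
qed

text \<open>
  The frame consists of the images of the unit vectors under the inverse isomorphism, divided by
  its norm \<open>c\<close>; this factor is moved to the coordinate functionals, whose joint bound is then the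
  product of the two norms.
\<close>

lemma l1_frame_of_isomorphism:
  fixes T :: "'a::real_normed_vector \<Rightarrow> ell1"
  assumes "subspace G" and iso: "isomorphism_on G (ell1_n n) T"
    and \<kappa>: "onorm_on G T * onorm_on (ell1_n n) (inv_into G T) \<le> \<kappa>"
  shows "\<exists>g a. l1_frame \<kappa> G n g a"
proof -
  define S where "S = inv_into G T"
  define c where "c = onorm_on (ell1_n n) S"
  have bT: "bounded_linear_on G T" and bS: "bounded_linear_on (ell1_n n) S" and bij: "bij_betw T G (ell1_n n)"
    using iso unfolding isomorphism_on_def S_def by auto
  have c0: "0 \<le> c"
    unfolding c_def using bS subspace_0[OF subspace_ell1_n] by (rule onorm_on_nonneg)
  obtain T' where T': "linear T'" "\<And>x. x \<in> G \<Longrightarrow> T' x = T x"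
    using linear_extension_from_subspace[OF assms(1) bT] by blast
  obtain S' where S': "linear S'" "\<And>x. x \<in> ell1_n n \<Longrightarrow> S' x = S x"
    using linear_extension_from_subspace[OF subspace_ell1_n bS] by blast
  define g where "g i = S' (unit_ell1 i) /\<^sub>R c" for i
  define a where "a i x = c * coord (T' x) i" for i x
  have "linear (a i)" for i
    unfolding a_def using linear_compose[OF T'(1) linear_coord[of i]]
    by (auto simp: linear_iff algebra_simps o_def)
  moreover have "norm (g i) \<le> 1" if "i < n" for i
  proof -
    have "norm (S' (unit_ell1 i)) \<le> c"
      using onorm_on_bound[OF bS unit_ell1_in_ell1_n[OF that]] S'(2)[OF unit_ell1_in_ell1_n[OF that]]
      by (simp add: c_def norm_unit_ell1)
    then show ?thesis using c0 by (cases "c = 0") (auto simp: g_def field_simps)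
  qed
  moreover have "(\<Sum>i<n. a i x *\<^sub>R g i) = x" "(\<Sum>i<n. \<bar>a i x\<bar>) \<le> \<kappa> * norm x" if x: "x \<in> G" for x
  proof -
    have Tx: "T x \<in> ell1_n n" using bij x by (auto simp: bij_betw_def)
    have STx: "S' (T x) = x"
      using S'(2)[OF Tx] bij x by (simp add: S_def bij_betw_def)
    have le: "norm x \<le> c * norm (T x)"
      using onorm_on_bound[OF bS Tx] S'(2)[OF Tx] STx by (simp add: c_def)
    show "(\<Sum>i<n. a i x *\<^sub>R g i) = x"
    \<comment> \<open>If \<open>c = 0\<close> then \<open>G\<close> is zero, and the division by \<open>c\<close> in \<open>g\<close> returns \<open>0\<close>.\<close>
    proof (cases "c = 0")
      case True
      then show ?thesis using le by (simp add: a_def)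
    next
      case False
      have "(\<Sum>i<n. a i x *\<^sub>R g i) = S' (\<Sum>i<n. coord (T x) i *\<^sub>R unit_ell1 i)"
        using False
        by (simp add: a_def g_def T'(2)[OF x] linear_sum[OF S'(1)] linear_scale[OF S'(1)] field_simps)
      then show ?thesis by (simp add: ell1_n_expansion[OF Tx] STx)
    qed
    have "(\<Sum>i<n. \<bar>a i x\<bar>) = c * norm (T x)"
      using c0 by (simp add: a_def T'(2)[OF x] norm_ell1_n[OF Tx] abs_mult sum_distrib_left)
    also have "\<dots> \<le> c * (onorm_on G T * norm x)"
      using onorm_on_bound[OF bT x] c0 by (intro mult_left_mono)
    also have "\<dots> \<le> \<kappa> * norm x"
      using mult_right_mono[OF \<kappa> norm_ge_zero[of x]] by (simp add: c_def S_def mult_ac)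
    finally show "(\<Sum>i<n. \<bar>a i x\<bar>) \<le> \<kappa> * norm x" .
  qed
  ultimately show ?thesis unfolding l1_frame_def by blast
qed

text \<open>
  The Banach-Mazur distance is an infimum that need not be attained; \<open>\<mu> + 1\<close> leaves room to pick an
  isomorphism.
\<close>

lemma script_L1_space_has_l1_frames:
  assumes "script_L1_space TYPE('a::banach)"
  shows "\<exists>\<kappa>. has_l1_frames \<kappa> TYPE('a)"
proof -
  obtain \<mu> :: real where \<mu>: "\<mu> \<ge> 1"
    and *: "\<And>F :: 'a set. finite_dim_subspace F \<Longrightarrow>
        \<exists>G. finite_dim_subspace G \<and> F \<subseteq> G \<and> banach_mazur_dist G (ell1_n (dim G)) \<le> ereal \<mu>"
    using assms unfolding script_L1_space_def by blast
  have "\<exists>n g a. l1_frame (\<mu> + 1) F n g a" if F: "finite_dim_subspace F" for F :: "'a set"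
  proof -
    obtain G where G: "finite_dim_subspace G" "F \<subseteq> G" "banach_mazur_dist G (ell1_n (dim G)) \<le> ereal \<mu>"
      using *[OF F] by blast
    have "banach_mazur_dist G (ell1_n (dim G)) < ereal (\<mu> + 1)"
      using G(3) by (rule order_le_less_trans) simp
    then obtain T where "isomorphism_on G (ell1_n (dim G)) T"
      "onorm_on G T * onorm_on (ell1_n (dim G)) (inv_into G T) \<le> \<mu> + 1"
      unfolding banach_mazur_dist_def INF_less_iff by auto
    then obtain g a where "l1_frame (\<mu> + 1) G (dim G) g a"
      using l1_frame_of_isomorphism[OF subspace_finite_dim[OF G(1)]] by blast
    then have "l1_frame (\<mu> + 1) F (dim G) g a"
      using G(2) unfolding l1_frame_def by blast
    then show ?thesis by blast
  qed
  with \<mu> show ?thesis unfolding has_l1_frames_def by (intro exI[of _ "\<mu> + 1"]) auto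
qed

text \<open>
  Every linear map on \<open>\<ell>\<^sub>1\<^sup>n\<close> is bounded by its values on the unit vectors, so a frame gives the
  automatic continuity of linear maps on finite dimensional subspaces.
\<close>

lemma linear_bounded_on_finite_dim:
  fixes f :: "'a::real_normed_vector \<Rightarrow> 'b::real_normed_vector"
  assumes "has_l1_frames \<kappa> TYPE('a)" "finite_dim_subspace F" "linear f"
  shows "\<exists>K\<ge>0. \<forall>x\<in>F. norm (f x) \<le> K * norm x"
proof -
  obtain n g a where fr: "l1_frame \<kappa> F n g a" and \<kappa>: "0 \<le> \<kappa>"
    using assms unfolding has_l1_frames_def by blast
  define M where "M = (\<Sum>i<n. norm (f (g i)))"
  have "norm (f x) \<le> M * \<kappa> * norm x" if x: "x \<in> F" for x
  proof -
    have "f x = (\<Sum>i<n. a i x *\<^sub>R f (g i))"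
      using fr x linear_sum[OF assms(3), of "\<lambda>i. a i x *\<^sub>R g i" "{..<n}"]
      by (simp add: l1_frame_def linear_scale[OF assms(3)])
    then have "norm (f x) \<le> (\<Sum>i<n. \<bar>a i x\<bar> * norm (f (g i)))"
      by (simp add: sum_norm_le)
    also have "\<dots> \<le> (\<Sum>i<n. \<bar>a i x\<bar> * M)"
      unfolding M_def by (intro sum_mono mult_left_mono member_le_sum) auto
    also have "\<dots> = M * (\<Sum>i<n. \<bar>a i x\<bar>)" by (simp add: sum_distrib_left mult.commute)
    also have "\<dots> \<le> M * (\<kappa> * norm x)"
      using fr x by (intro mult_left_mono) (auto simp: l1_frame_def M_def sum_nonneg)
    finally show ?thesis by (simp add: mult.assoc)
  qed
  moreover have "0 \<le> M * \<kappa>" unfolding M_def using \<kappa> by (simp add: sum_nonneg)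
  ultimately show ?thesis by blast
qed

section \<open>Convergent refinements of bounded nets\<close>

text \<open>
  Tychonoff's theorem: the values of \<open>h\<close> lie in a compact product of intervals, so the net has a
  cluster point \<open>H\<close>, and refining the filter by the neighbourhoods of \<open>H\<close> makes it convergent. The
  finer filter \<open>F'\<close> plays the role of an ultrafilter, in that all coordinates converge along it at
  the same time.
\<close>

lemma bounded_real_net_subnet:
  fixes h :: "'s \<Rightarrow> 'i \<Rightarrow> real"
  assumes "F \<noteq> bot" and bound: "\<And>s i. \<bar>h s i\<bar> \<le> c i"
  obtains F' H where "F' \<le> F" "F' \<noteq> bot" "\<And>i. ((\<lambda>s. h s i) \<longlongrightarrow> H i) F'"
proof -
  let ?K = "PiE UNIV (\<lambda>i. {- c i..c i})"
  have "compactin (product_topology (\<lambda>i. euclidean) UNIV) ?K"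
    by (subst compactin_PiE) auto
  then have "compact ?K"
    by (simp add: euclidean_product_topology)
  moreover have "filtermap h F \<noteq> bot"
    using assms(1) by (simp add: filtermap_bot_iff)
  moreover have "eventually (\<lambda>x. x \<in> ?K) (filtermap h F)"
    unfolding eventually_filtermap using bound by (intro always_eventually) (auto simp: abs_le_iff minus_le_iff)
  ultimately obtain H where H: "inf (nhds H) (filtermap h F) \<noteq> bot"
    unfolding compact_filter by blast
  define F' where "F' = inf F (filtercomap h (nhds H))"
  have "F' \<noteq> bot"
  proof
    assume "F' = bot"
    then have "eventually (\<lambda>_. False) (inf F (filtercomap h (nhds H)))"
      by (simp add: F'_def)
    then obtain Q R where QR: "eventually Q F" "eventually R (filtercomap h (nhds H))"
      "\<And>s. Q s \<Longrightarrow> R s \<Longrightarrow> False"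
      unfolding eventually_inf by blast
    then obtain R' where R': "eventually R' (nhds H)" "\<And>s. R' (h s) \<Longrightarrow> R s"
      unfolding eventually_filtercomap by blast
    have "eventually (\<lambda>y. \<not> R' y) (filtermap h F)"
      unfolding eventually_filtermap using QR(1) by eventually_elim (use QR(3) R'(2) in blast)
    with R'(1) have "eventually (\<lambda>_. False) (inf (nhds H) (filtermap h F))"
      unfolding eventually_inf by blast
    with H show False by (simp add: eventually_False)
  qed
  moreover have "((\<lambda>s. h s i) \<longlongrightarrow> H i) F'" for i
  proof -
    have "(h \<longlongrightarrow> H) F'"
      unfolding F'_def by (simp add: filterlim_iff_le_filtercomap)
    moreover have "((\<lambda>f. f i) \<longlongrightarrow> H i) (nhds H)"
    proof -
      have "open ((\<lambda>f :: 'i \<Rightarrow> real. f i) -` S)" if "open S" for S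
        using that by (intro open_vimage) simp_all
      then show ?thesis
        by (intro topological_tendstoI) (auto simp: eventually_nhds vimage_def)
    qed
    ultimately show ?thesis using filterlim_compose[of "\<lambda>f. f i" "nhds (H i)" "nhds H" h F'] by blast
  qed
  moreover have "F' \<le> F" unfolding F'_def by simp
  ultimately show ?thesis using that by blast
qed

text \<open>
  Only the coordinates in a frame for \<open>E\<close> are passed to the limit. The limits lie in the span of the
  frame vectors, which need not be contained in \<open>E\<close>.
\<close>

lemma bounded_finite_dim_net_subnet:
  fixes h :: "'s \<Rightarrow> 'i \<Rightarrow> 'b::real_normed_vector"
  assumes fr: "has_l1_frames \<kappa> TYPE('b)" and E: "finite_dim_subspace E" and "F \<noteq> bot"
    and h: "\<And>s i. h s i \<in> E" "\<And>s i. norm (h s i) \<le> c i"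
  shows "\<exists>F' V. F' \<le> F \<and> F' \<noteq> bot \<and> (\<forall>i. ((\<lambda>s. h s i) \<longlongrightarrow> V i) F') \<and>
    (\<exists>E'. finite_dim_subspace E' \<and> range V \<subseteq> E')"
proof -
  have \<kappa>: "0 \<le> \<kappa>" using fr by (simp add: has_l1_frames_def)
  obtain n g a where fra: "l1_frame \<kappa> E n g a"
    using fr E unfolding has_l1_frames_def by blast
  define r where "r s p = (if fst p < n then a (fst p) (h s (snd p)) else 0)" for s and p :: "nat \<times> 'i"
  have "\<bar>r s p\<bar> \<le> \<kappa> * c (snd p)" for s p
  proof (cases "fst p < n")
    case True
    then have "\<bar>r s p\<bar> \<le> (\<Sum>k<n. \<bar>a k (h s (snd p))\<bar>)"
      unfolding r_def using member_le_sum[of "fst p" "{..<n}" "\<lambda>k. \<bar>a k (h s (snd p))\<bar>"] by simp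
    also have "\<dots> \<le> \<kappa> * norm (h s (snd p))" using fra h(1) by (simp add: l1_frame_def)
    also have "\<dots> \<le> \<kappa> * c (snd p)" by (intro mult_left_mono h(2) \<kappa>)
    finally show ?thesis .
  next
    case False
    then show ?thesis using \<kappa> order_trans[OF norm_ge_zero h(2)] by (simp add: r_def)
  qed
  then obtain F' H where F': "F' \<le> F" "F' \<noteq> bot" and H: "\<And>p. ((\<lambda>s. r s p) \<longlongrightarrow> H p) F'"
    using bounded_real_net_subnet[OF assms(3), of r "\<lambda>p. \<kappa> * c (snd p)"] by metis
  define V where "V i = (\<Sum>k<n. H (k, i) *\<^sub>R g k)" for i
  have "((\<lambda>s. h s i) \<longlongrightarrow> V i) F'" for i
  proof -
    have "h s i = (\<Sum>k<n. r s (k, i) *\<^sub>R g k)" for s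
      using fra h(1)[of s i] by (simp add: l1_frame_def r_def)
    then show ?thesis unfolding V_def by (simp only:) (intro tendsto_intros H)
  qed
  moreover have "range V \<subseteq> span (g ` {..<n})"
    unfolding V_def by (intro image_subsetI span_sum span_scale span_base imageI)
  ultimately show ?thesis using F' finite_dim_subspace_span[of "g ` {..<n}"] by blast
qed

section \<open>The bounded approximation property of \<open>\<L>\<^sub>1\<close>-spaces\<close>

text \<open>
  Think of \<open>u = t \<cdot> h\<close> with a ratio \<open>t\<close> that varies by at most \<open>\<delta>\<close> over \<open>I\<close>. Spreading the total mass of
  \<open>u\<close> over \<open>I\<close> proportionally to \<open>h\<close> replaces \<open>t\<close> by its average. The condition on \<open>t\<close> is written
  without quotients so that \<open>h\<close> may vanish.
\<close>

lemma class_average_error: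
  fixes u h :: "'i \<Rightarrow> real"
  assumes "finite I" "i \<in> I" and le: "\<And>j. j \<in> I \<Longrightarrow> \<bar>u j\<bar> \<le> h j"
    and osc: "\<And>j j'. j \<in> I \<Longrightarrow> j' \<in> I \<Longrightarrow> \<bar>u j * h j' - u j' * h j\<bar> \<le> \<delta> * h j * h j'"
  shows "\<bar>u i - sum u I * (h i / sum h I)\<bar> \<le> \<delta> * h i"
proof (cases "sum h I = 0")
  case True
  have "0 \<le> h j" if "j \<in> I" for j using le[OF that] by linarith
  then have "h i = 0" using True assms(1,2) by (simp add: sum_nonneg_eq_0_iff)
  then show ?thesis using le[OF assms(2)] by simp
next
  case False
  have h0: "0 \<le> h j" if "j \<in> I" for j using le[OF that] by linarith
  have pos: "0 < sum h I" using False sum_nonneg[of I h] h0 by fastforce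
  have "\<bar>u i * sum h I - sum u I * h i\<bar> = \<bar>\<Sum>j\<in>I. u i * h j - u j * h i\<bar>"
    by (simp add: sum_subtractf sum_distrib_left sum_distrib_right)
  also have "\<dots> \<le> (\<Sum>j\<in>I. \<delta> * h i * h j)"
    by (rule order_trans[OF sum_abs]) (intro sum_mono osc assms(2))
  finally have "\<bar>u i * sum h I - sum u I * h i\<bar> \<le> \<delta> * h i * sum h I"
    by (simp add: sum_distrib_left)
  moreover have "u i - sum u I * (h i / sum h I) = (u i * sum h I - sum u I * h i) / sum h I"
    using pos by (simp add: field_simps)
  ultimately show ?thesis using pos by (simp add: field_simps)
qed

lemma same_floor_oscillation:
  fixes u v h k :: real
  assumes "\<bar>u\<bar> \<le> h" "\<bar>v\<bar> \<le> k" "0 < N" "\<lfloor>real N * (u / h)\<rfloor> = \<lfloor>real N * (v / k)\<rfloor>"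
  shows "\<bar>u * k - v * h\<bar> \<le> 1 / real N * h * k"
proof (cases "h = 0 \<or> k = 0")
  case True
  then show ?thesis using assms by auto
next
  case False
  then have hk: "0 < h" "0 < k" using assms by auto
  have "\<bar>real N * (u / h) - real N * (v / k)\<bar> \<le> 1"
    using assms(4) by linarith
  moreover have "real N * (u / h) - real N * (v / k) = real N * (u / h - v / k)"
    by (rule right_diff_distrib[symmetric])
  ultimately have "real N * \<bar>u / h - v / k\<bar> \<le> 1"
    by (simp only: abs_mult abs_of_nat)
  then have "\<bar>u / h - v / k\<bar> \<le> 1 / real N"
    using assms(3) by (simp only: pos_le_divide_eq of_nat_0_less_iff mult.commute)
  then have "\<bar>u / h - v / k\<bar> * (h * k) \<le> 1 / real N * (h * k)"
    using hk by (intro mult_right_mono) auto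
  moreover have "\<bar>u / h - v / k\<bar> * (h * k) = \<bar>u * k - v * h\<bar>"
  proof -
    have "\<bar>u / h - v / k\<bar> * (h * k) = \<bar>(u / h - v / k) * (h * k)\<bar>"
      using hk by (simp add: abs_mult)
    also have "(u / h - v / k) * (h * k) = u * k - v * h"
      using hk by (simp add: field_simps)
    finally show ?thesis .
  qed
  ultimately show ?thesis by (simp add: mult.assoc)
qed

text \<open>
  This is the uniform approximation property of \<open>\<ell>\<^sub>1\<close>: on finitely many vectors \<open>D\<close> the expansion in a
  frame of arbitrary length \<open>n\<close> can be replaced, up to a small error, by one whose length, the
  cardinality of \<open>Keys\<close>, depends on \<open>D\<close> and \<open>N\<close> only. Coordinates are classified
  by the integer parts of \<open>N a\<^sub>i d / h\<^sub>i\<close>, where \<open>h\<^sub>i\<close> is the sum of the \<open>\<bar>a\<^sub>i d\<bar>\<close> over \<open>D\<close>; within a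
  class, the ratios \<open>a\<^sub>i d / h\<^sub>i\<close> of each \<open>d\<close> differ by at most \<open>1 / N\<close>. A class functional \<open>\<phi>\<^sub>k\<close> adds the coordinates of its class, and \<open>w\<^sub>k\<close> is the average of the frame
  vectors of the class with weights \<open>h\<^sub>i\<close>; every \<open>d\<close> in \<open>D\<close> is nearly constant relative to \<open>h\<close> on
  each class.
\<close>

lemma l1_frame_coarsening:
  fixes D :: "'a::real_normed_vector set"
  assumes fr: "l1_frame \<kappa> F n g a" and D: "finite D" "D \<subseteq> F" and N: "0 < N"
  defines "Keys \<equiv> PiE D (\<lambda>_. {- int N..int N})"
  shows "\<exists>\<phi> w. (\<forall>k. linear (\<phi> k)) \<and> (\<forall>k. norm (w k) \<le> 1) \<and>
    (\<forall>x\<in>F. (\<Sum>k\<in>Keys. \<bar>\<phi> k x\<bar>) \<le> \<kappa> * norm x) \<and>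
    (\<forall>d\<in>D. norm ((\<Sum>k\<in>Keys. \<phi> k d *\<^sub>R w k) - d) \<le> \<kappa> * (\<Sum>d\<in>D. norm d) / real N)"
proof -
  have lin: "linear (a i)" for i using fr by (simp add: l1_frame_def)
  have g1: "norm (g i) \<le> 1" if "i < n" for i using fr that by (simp add: l1_frame_def)
  have exp: "(\<Sum>i<n. a i x *\<^sub>R g i) = x" "(\<Sum>i<n. \<bar>a i x\<bar>) \<le> \<kappa> * norm x" if "x \<in> F" for x
    using fr that by (auto simp: l1_frame_def)
  define h where "h i = (\<Sum>d\<in>D. \<bar>a i d\<bar>)" for i
  have h0: "0 \<le> h i" for i unfolding h_def by (simp add: sum_nonneg)
  have ah: "\<bar>a i d\<bar> \<le> h i" if "d \<in> D" for i d
    unfolding h_def using D(1) that by (intro member_le_sum[of d D "\<lambda>d. \<bar>a i d\<bar>"]) auto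
  define key where "key i = (\<lambda>d\<in>D. \<lfloor>real N * (a i d / h i)\<rfloor>)" for i
  define C where "C k = {i\<in>{..<n}. key i = k}" for k
  define \<phi> where "\<phi> k x = (\<Sum>i\<in>C k. a i x)" for k x
  define w where "w k = (\<Sum>i\<in>C k. (h i / sum h (C k)) *\<^sub>R g i)" for k
  have finK: "finite Keys" unfolding Keys_def using D(1) by (intro finite_PiE) auto
  have keyK: "key ` {..<n} \<subseteq> Keys"
  proof -
    have "\<lfloor>real N * (a i d / h i)\<rfloor> \<in> {- int N..int N}" if "d \<in> D" for i d
    proof -
      have "\<bar>a i d / h i\<bar> \<le> 1"
        using ah[OF that, of i] h0[of i] by (cases "h i = 0") (auto simp: field_simps)
      then have "\<bar>real N * (a i d / h i)\<bar> \<le> real N"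
        using mult_left_mono[of "\<bar>a i d / h i\<bar>" 1 "real N"] by (simp add: abs_mult)
      then have le: "of_int (- int N) \<le> real N * (a i d / h i)" "real N * (a i d / h i) < of_int (int N) + 1"
        by (simp_all only: abs_le_iff of_int_minus of_int_of_nat_eq) linarith+
      have "- int N \<le> \<lfloor>real N * (a i d / h i)\<rfloor>"
        using le(1) by (simp only: le_floor_iff)
      moreover have "\<lfloor>real N * (a i d / h i)\<rfloor> \<le> int N"
        using le(2) by (simp only: floor_le_iff)
      ultimately show ?thesis by simp
    qed
    then show ?thesis unfolding key_def Keys_def by auto
  qed
  have group: "(\<Sum>k\<in>Keys. \<Sum>i\<in>C k. f i) = (\<Sum>i<n. f i)" for f :: "nat \<Rightarrow> real"
    unfolding C_def using finK keyK by (intro sum.group) auto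
  have group': "(\<Sum>k\<in>Keys. \<Sum>i\<in>C k. f i) = (\<Sum>i<n. f i)" for f :: "nat \<Rightarrow> 'a"
    unfolding C_def using finK keyK by (intro sum.group) auto
  have finC: "finite (C k)" for k unfolding C_def by simp
  have "linear (\<phi> k)" for k
    unfolding \<phi>_def using lin by (intro linear_compose_sum) auto
  moreover have "norm (w k) \<le> 1" for k
  proof -
    have "norm (w k) \<le> (\<Sum>i\<in>C k. h i / sum h (C k))"
      unfolding w_def
    proof (rule sum_norm_le)
      fix i assume "i \<in> C k"
      then have "norm (g i) \<le> 1" using g1 by (simp add: C_def)
      moreover have "0 \<le> h i / sum h (C k)" using h0 by (simp add: sum_nonneg)
      ultimately show "norm ((h i / sum h (C k)) *\<^sub>R g i) \<le> h i / sum h (C k)"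
        using mult_left_le[of "norm (g i)" "h i / sum h (C k)"]
        by (simp only: norm_scaleR abs_of_nonneg)
    qed
    also have "\<dots> = sum h (C k) / sum h (C k)"
      by (rule sum_divide_distrib[symmetric])
    also have "\<dots> \<le> 1" by (cases "sum h (C k) = 0") auto
    finally show ?thesis .
  qed
  moreover have "(\<Sum>k\<in>Keys. \<bar>\<phi> k x\<bar>) \<le> \<kappa> * norm x" if "x \<in> F" for x
  proof -
    have "(\<Sum>k\<in>Keys. \<bar>\<phi> k x\<bar>) \<le> (\<Sum>k\<in>Keys. \<Sum>i\<in>C k. \<bar>a i x\<bar>)"
      unfolding \<phi>_def by (intro sum_mono sum_abs)
    then show ?thesis using exp(2)[OF that] by (simp add: group)
  qed
  moreover have "norm ((\<Sum>k\<in>Keys. \<phi> k d *\<^sub>R w k) - d) \<le> \<kappa> * (\<Sum>d\<in>D. norm d) / real N" if d: "d \<in> D" for d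
  proof -
    define b where "b i = \<phi> (key i) d * (h i / sum h (C (key i)))" for i
    have "(\<Sum>k\<in>Keys. \<phi> k d *\<^sub>R w k) = (\<Sum>k\<in>Keys. \<Sum>i\<in>C k. b i *\<^sub>R g i)"
      unfolding w_def b_def scaleR_sum_right by (intro sum.cong refl) (simp add: C_def)
    also have "\<dots> = (\<Sum>i<n. b i *\<^sub>R g i)" by (rule group')
    finally have "(\<Sum>k\<in>Keys. \<phi> k d *\<^sub>R w k) - d = (\<Sum>i<n. b i *\<^sub>R g i) - (\<Sum>i<n. a i d *\<^sub>R g i)"
      using exp(1)[of d] d D(2) by auto
    also have "\<dots> = (\<Sum>i<n. (b i - a i d) *\<^sub>R g i)"
      by (simp only: scaleR_diff_left sum_subtractf)
    finally have "norm ((\<Sum>k\<in>Keys. \<phi> k d *\<^sub>R w k) - d) = norm (\<Sum>i<n. (b i - a i d) *\<^sub>R g i)"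
      by simp
    also have "\<dots> \<le> (\<Sum>i<n. 1 / real N * h i)"
    proof (rule sum_norm_le)
      fix i assume i: "i \<in> {..<n}"
      have key_eq: "\<lfloor>real N * (a j d / h j)\<rfloor> = \<lfloor>real N * (a i d / h i)\<rfloor>" if "j \<in> C (key i)" for j
      proof -
        have "key j d = key i d" using that by (simp add: C_def)
        then show ?thesis using d by (simp add: key_def)
      qed
      have "\<bar>a i d - sum (\<lambda>i. a i d) (C (key i)) * (h i / sum h (C (key i)))\<bar> \<le> 1 / real N * h i"
      proof (rule class_average_error)
        show "i \<in> C (key i)" using i by (simp add: C_def)
        show "\<bar>a j d * h j' - a j' d * h j\<bar> \<le> 1 / real N * h j * h j'"
          if "j \<in> C (key i)" "j' \<in> C (key i)" for j j'
          using key_eq[OF that(1)] key_eq[OF that(2)] ah[OF d] N by (intro same_floor_oscillation) auto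
      qed (use ah d finC in auto)
      then have "\<bar>b i - a i d\<bar> \<le> 1 / real N * h i"
        by (simp add: b_def \<phi>_def abs_minus_commute)
      moreover have "norm ((b i - a i d) *\<^sub>R g i) \<le> \<bar>b i - a i d\<bar>"
        using g1 i by (simp add: mult_left_le)
      ultimately show "norm ((b i - a i d) *\<^sub>R g i) \<le> 1 / real N * h i" by linarith
    qed
    also have "\<dots> = (\<Sum>d\<in>D. \<Sum>i<n. \<bar>a i d\<bar>) / real N"
      unfolding h_def using sum.swap[of "\<lambda>i d. \<bar>a i d\<bar>" D "{..<n}"]
      by (simp add: sum_divide_distrib[symmetric])
    also have "\<dots> \<le> (\<Sum>d\<in>D. \<kappa> * norm d) / real N"
      by (intro divide_right_mono sum_mono exp(2) subsetD[OF D(2)]) auto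
    finally show ?thesis by (simp add: sum_distrib_left)
  qed
  ultimately show ?thesis by (intro exI[of _ \<phi>] exI[of _ w] conjI allI ballI)
qed

lemma eventually_span_union:
  "\<forall>\<^sub>F s in finite_subsets_at_top UNIV. finite s \<and> x \<in> span (D \<union> s)"
proof -
  have "\<forall>\<^sub>F s in finite_subsets_at_top (UNIV :: 'a::real_vector set). finite s \<and> {x} \<subseteq> s \<and> s \<subseteq> UNIV"
    by (simp add: eventually_finite_subsets_at_top) (rule exI[of _ "{x}"], auto)
  then show ?thesis
    by eventually_elim (auto intro: span_base)
qed

text \<open>
  The coarsened expansions \<open>\<Sum>\<^sub>k \<phi> s k x \<cdot> w s k\<close> on the subspaces spanned by \<open>D\<close> and finite sets \<open>s\<close> have
  a common finite index set, so their functionals have limits \<open>H\<^sub>k\<close> defined on the whole space with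
  \<open>\<Sum>\<^sub>k \<bar>H\<^sub>k x\<bar> \<le> \<kappa> \<parallel>x\<parallel>\<close>. The vectors \<open>w s k\<close> need not converge, but this does no harm: combining the
  limit functionals with the vectors of one single far enough \<open>s\<close> keeps the norm bound, because that
  bound uses only \<open>\<parallel>w s k\<parallel> \<le> 1\<close>, and changes the values on \<open>D\<close> by arbitrarily little.
\<close>

lemma l1_frames_approximation:
  fixes D :: "'a::real_normed_vector set"
  assumes fr: "has_l1_frames \<kappa> TYPE('a)" and D: "finite D" and \<epsilon>: "0 < \<epsilon>"
  shows "\<exists>S E. linear S \<and> finite_dim_subspace E \<and> range S \<subseteq> E \<and>
    (\<forall>x. norm (S x) \<le> \<kappa> * norm x) \<and> (\<forall>d\<in>D. norm (S d - d) \<le> \<epsilon>)"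
proof -
  define c where "c = \<kappa> * (\<Sum>d\<in>D. norm d)"
  obtain N0 :: nat where N0: "2 * c / \<epsilon> < real N0"
    using reals_Archimedean2 by blast
  define N where "N = Suc N0"
  have N: "0 < N" by (simp add: N_def)
  have cN: "c / real N \<le> \<epsilon> / 2"
    using N0 \<epsilon> by (simp add: N_def field_simps)
  have \<kappa>: "0 \<le> \<kappa>" using fr by (simp add: has_l1_frames_def)
  define Keys where "Keys = PiE D (\<lambda>_. {- int N..int N})"
  have finK: "finite Keys" unfolding Keys_def using D by (intro finite_PiE) auto
  define good where "good s \<phi> w \<longleftrightarrow> (\<forall>k. linear (\<phi> k)) \<and> (\<forall>k. norm (w k) \<le> 1) \<and>
    (\<forall>x\<in>span (D \<union> s). (\<Sum>k\<in>Keys. \<bar>\<phi> k x\<bar>) \<le> \<kappa> * norm x) \<and>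
    (\<forall>d\<in>D. norm ((\<Sum>k\<in>Keys. \<phi> k d *\<^sub>R w k) - d) \<le> c / real N)"
    for s and \<phi> :: "('a \<Rightarrow> int) \<Rightarrow> 'a \<Rightarrow> real" and w :: "('a \<Rightarrow> int) \<Rightarrow> 'a"
  have "\<exists>\<phi> w. good s \<phi> w" if s: "finite s" for s
  proof -
    obtain n g a where fra: "l1_frame \<kappa> (span (D \<union> s)) n g a"
      using fr s D finite_dim_subspace_span[of "D \<union> s"] unfolding has_l1_frames_def by blast
    have "D \<subseteq> span (D \<union> s)" by (auto intro: span_base)
    from l1_frame_coarsening[OF fra D this N] show ?thesis
      unfolding good_def Keys_def c_def .
  qed
  then obtain \<phi> w where good: "\<And>s. finite s \<Longrightarrow> good s (\<phi> s) (w s)"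
    by metis
  have lin: "linear (\<phi> s k)" and w: "norm (w s k) \<le> 1" if "finite s" for s k
    using good[OF that] by (auto simp: good_def)
  have bd: "(\<Sum>k\<in>Keys. \<bar>\<phi> s k x\<bar>) \<le> \<kappa> * norm x" if "finite s" "x \<in> span (D \<union> s)" for s x
    using good[OF that(1)] that(2) by (auto simp: good_def)
  have ap: "norm ((\<Sum>k\<in>Keys. \<phi> s k d *\<^sub>R w s k) - d) \<le> c / real N" if "finite s" "d \<in> D" for s d
    using good[OF that(1)] that(2) by (auto simp: good_def)
  \<comment> \<open>Extension by zero off the subspaces, so that the bound holds for all indices.\<close>
  define h where "h s i = (if finite s \<and> snd i \<in> span (D \<union> s) \<and> fst i \<in> Keys then \<phi> s (fst i) (snd i) else 0)"
    for s i
  have "\<bar>h s i\<bar> \<le> \<kappa> * norm (snd i)" for s i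
  proof (cases "finite s \<and> snd i \<in> span (D \<union> s) \<and> fst i \<in> Keys")
    case True
    then have "\<bar>h s i\<bar> \<le> (\<Sum>k\<in>Keys. \<bar>\<phi> s k (snd i)\<bar>)"
      unfolding h_def using finK member_le_sum[of "fst i" Keys "\<lambda>k. \<bar>\<phi> s k (snd i)\<bar>"] by simp
    then show ?thesis using bd[of s "snd i"] True by linarith
  next
    case False
    then show ?thesis using \<kappa> by (auto simp: h_def)
  qed
  then obtain F' H where F': "F' \<le> finite_subsets_at_top UNIV" "F' \<noteq> bot"
    and H: "\<And>i. ((\<lambda>s. h s i) \<longlongrightarrow> H i) F'"
    using bounded_real_net_subnet[of "finite_subsets_at_top UNIV" h "\<lambda>i. \<kappa> * norm (snd i)"]
    by (metis finite_subsets_at_top_neq_bot)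
  have ev: "\<forall>\<^sub>F s in F'. finite s \<and> x \<in> span (D \<union> s)" for x
    using eventually_span_union F'(1) by (rule filter_leD[rotated])
  have lim: "((\<lambda>s. \<phi> s k x) \<longlongrightarrow> H (k, x)) F'" if "k \<in> Keys" for k x
    using H[of "(k, x)"]
  proof (rule Lim_transform_eventually)
    show "\<forall>\<^sub>F s in F'. h s (k, x) = \<phi> s k x"
      using ev[of x] by eventually_elim (use that in \<open>simp add: h_def\<close>)
  qed
  have fin: "\<forall>\<^sub>F s in F'. finite s" using ev by (rule eventually_mono) auto
  have linH: "linear (\<lambda>x. H (k, x))" if k: "k \<in> Keys" for k
  proof (rule linearI)
    fix x y :: 'a and r :: real
    have "((\<lambda>s. \<phi> s k x + \<phi> s k y) \<longlongrightarrow> H (k, x + y)) F'"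
      using lim[OF k, of "x + y"]
    proof (rule Lim_transform_eventually)
      show "\<forall>\<^sub>F s in F'. \<phi> s k (x + y) = \<phi> s k x + \<phi> s k y"
        using fin by eventually_elim (simp add: lin linear_add)
    qed
    then show "H (k, x + y) = H (k, x) + H (k, y)"
      by (rule tendsto_unique[OF F'(2)]) (intro tendsto_intros lim k)
    have "((\<lambda>s. r *\<^sub>R \<phi> s k x) \<longlongrightarrow> H (k, r *\<^sub>R x)) F'"
      using lim[OF k, of "r *\<^sub>R x"]
    proof (rule Lim_transform_eventually)
      show "\<forall>\<^sub>F s in F'. \<phi> s k (r *\<^sub>R x) = r *\<^sub>R \<phi> s k x"
        using fin by eventually_elim (simp only: lin linear_scale)
    qed
    then show "H (k, r *\<^sub>R x) = r *\<^sub>R H (k, x)"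
      by (rule tendsto_unique[OF F'(2)]) (intro tendsto_intros lim k)
  qed
  have bdH: "(\<Sum>k\<in>Keys. \<bar>H (k, x)\<bar>) \<le> \<kappa> * norm x" for x
  proof (rule tendsto_upperbound[OF _ _ F'(2)])
    show "((\<lambda>s. \<Sum>k\<in>Keys. \<bar>\<phi> s k x\<bar>) \<longlongrightarrow> (\<Sum>k\<in>Keys. \<bar>H (k, x)\<bar>)) F'"
      by (intro tendsto_intros lim)
    show "\<forall>\<^sub>F s in F'. (\<Sum>k\<in>Keys. \<bar>\<phi> s k x\<bar>) \<le> \<kappa> * norm x"
      using ev[of x] by eventually_elim (simp add: bd)
  qed
  have "\<forall>\<^sub>F s in F'. (\<Sum>k\<in>Keys. \<bar>H (k, d) - \<phi> s k d\<bar>) < \<epsilon> / 2" for d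
  proof (rule order_tendstoD(2))
    have "((\<lambda>s. \<Sum>k\<in>Keys. \<bar>H (k, d) - \<phi> s k d\<bar>) \<longlongrightarrow> (\<Sum>k\<in>Keys. \<bar>H (k, d) - H (k, d)\<bar>)) F'"
      by (intro tendsto_intros lim)
    then show "((\<lambda>s. \<Sum>k\<in>Keys. \<bar>H (k, d) - \<phi> s k d\<bar>) \<longlongrightarrow> 0) F'" by simp
  qed (use \<epsilon> in simp)
  then have "\<forall>\<^sub>F s in F'. \<forall>d\<in>D. (\<Sum>k\<in>Keys. \<bar>H (k, d) - \<phi> s k d\<bar>) < \<epsilon> / 2"
    using D by (intro eventually_ball_finite) auto
  with fin have "\<forall>\<^sub>F s in F'. finite s \<and> (\<forall>d\<in>D. (\<Sum>k\<in>Keys. \<bar>H (k, d) - \<phi> s k d\<bar>) < \<epsilon> / 2)"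
    by eventually_elim simp
  then obtain s where s: "finite s" and close: "\<And>d. d \<in> D \<Longrightarrow> (\<Sum>k\<in>Keys. \<bar>H (k, d) - \<phi> s k d\<bar>) < \<epsilon> / 2"
    using eventually_happens'[OF F'(2)] by blast
  define S where "S x = (\<Sum>k\<in>Keys. H (k, x) *\<^sub>R w s k)" for x
  have norm_comb: "norm (\<Sum>k\<in>Keys. r k *\<^sub>R w s k) \<le> (\<Sum>k\<in>Keys. \<bar>r k\<bar>)" for r
    using w[OF s] by (intro sum_norm_le) (simp add: mult_left_le)
  have "linear S"
    unfolding S_def
    by (rule linearI) (simp_all add: linear_add[OF linH] linear_scale[OF linH] scaleR_add_left
        sum.distrib scaleR_sum_right)
  moreover have "finite_dim_subspace (span (w s ` Keys))"
    using finK by (intro finite_dim_subspace_span) auto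
  moreover have "range S \<subseteq> span (w s ` Keys)"
    unfolding S_def by (intro image_subsetI span_sum span_scale span_base imageI)
  moreover have "norm (S x) \<le> \<kappa> * norm x" for x
    unfolding S_def by (rule order_trans[OF norm_comb bdH])
  moreover have "norm (S d - d) \<le> \<epsilon>" if d: "d \<in> D" for d
  proof -
    have "S d - d = (\<Sum>k\<in>Keys. (H (k, d) - \<phi> s k d) *\<^sub>R w s k) + ((\<Sum>k\<in>Keys. \<phi> s k d *\<^sub>R w s k) - d)"
      unfolding S_def by (simp add: scaleR_diff_left sum_subtractf)
    also have "norm \<dots> \<le> (\<Sum>k\<in>Keys. \<bar>H (k, d) - \<phi> s k d\<bar>) + c / real N"
      by (intro norm_triangle_mono norm_comb ap s d)
    also have "\<dots> \<le> \<epsilon>" using close[OF d] cN by linarith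
    finally show ?thesis .
  qed
  ultimately show ?thesis by blast
qed

text \<open>
  If \<open>S\<close> almost fixes the vectors \<open>g\<^sub>i\<close> of a frame for \<open>F\<close>, then it almost fixes all of \<open>F\<close>, with an
  error relative to the norm.
\<close>

lemma l1_frames_approximation_on_subspace:
  fixes F :: "'a::real_normed_vector set"
  assumes fr: "has_l1_frames \<kappa> TYPE('a)" and F: "finite_dim_subspace F" and \<epsilon>: "0 < \<epsilon>"
  shows "\<exists>S E. linear S \<and> finite_dim_subspace E \<and> range S \<subseteq> E \<and>
    (\<forall>x. norm (S x) \<le> \<kappa> * norm x) \<and> (\<forall>x\<in>F. norm (S x - x) \<le> \<epsilon> * norm x)"
proof -
  obtain n g a where fra: "l1_frame \<kappa> F n g a"
    using fr F unfolding has_l1_frames_def by blast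
  have \<kappa>: "0 \<le> \<kappa>" using fr by (simp add: has_l1_frames_def)
  obtain S E where S: "linear S" "finite_dim_subspace E" "range S \<subseteq> E" "\<And>x. norm (S x) \<le> \<kappa> * norm x"
    and close: "\<And>d. d \<in> g ` {..<n} \<Longrightarrow> norm (S d - d) \<le> \<epsilon> / (\<kappa> + 1)"
  proof -
    have "finite (g ` {..<n})" "0 < \<epsilon> / (\<kappa> + 1)" using \<epsilon> \<kappa> by auto
    from l1_frames_approximation[OF fr this] show ?thesis using that by blast
  qed
  have "norm (S x - x) \<le> \<epsilon> * norm x" if x: "x \<in> F" for x
  proof -
    have exp: "(\<Sum>i<n. a i x *\<^sub>R g i) = x" and bd: "(\<Sum>i<n. \<bar>a i x\<bar>) \<le> \<kappa> * norm x"
      using fra x by (auto simp: l1_frame_def)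
    have "S x = (\<Sum>i<n. a i x *\<^sub>R S (g i))"
      using linear_sum[OF S(1), of "\<lambda>i. a i x *\<^sub>R g i" "{..<n}"] exp by (simp add: linear_scale[OF S(1)])
    then have "S x - x = (\<Sum>i<n. a i x *\<^sub>R (S (g i) - g i))"
      using exp by (simp add: scaleR_diff_right sum_subtractf)
    also have "norm \<dots> \<le> (\<Sum>i<n. \<bar>a i x\<bar> * (\<epsilon> / (\<kappa> + 1)))"
    proof (rule sum_norm_le)
      fix i assume "i \<in> {..<n}"
      then have "norm (S (g i) - g i) \<le> \<epsilon> / (\<kappa> + 1)" by (intro close imageI)
      then show "norm (a i x *\<^sub>R (S (g i) - g i)) \<le> \<bar>a i x\<bar> * (\<epsilon> / (\<kappa> + 1))"
        unfolding norm_scaleR by (intro mult_left_mono) simp_all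
    qed
    also have "\<dots> = (\<Sum>i<n. \<bar>a i x\<bar>) * (\<epsilon> / (\<kappa> + 1))"
      by (rule sum_distrib_right[symmetric])
    also have "\<dots> \<le> (\<kappa> * norm x) * (\<epsilon> / (\<kappa> + 1))"
      using bd \<epsilon> \<kappa> by (intro mult_right_mono) auto
    also have "\<dots> = (\<kappa> / (\<kappa> + 1)) * (\<epsilon> * norm x)" by simp
    also have "\<dots> \<le> 1 * (\<epsilon> * norm x)"
      using \<epsilon> \<kappa> by (intro mult_right_mono) auto
    finally show ?thesis by simp
  qed
  with S show ?thesis by blast
qed

text \<open>
  An operator \<open>S\<close> that moves each \<open>x \<in> F\<close> by at most half its norm is injective on \<open>F\<close>. A linear left
  inverse of this restriction is bounded on the finite dimensional range of \<open>S\<close>, and composing the two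
  gives the projection.
\<close>

lemma l1_frames_bounded_projection:
  fixes F :: "'a::real_normed_vector set"
  assumes fr: "has_l1_frames \<kappa> TYPE('a)" and F: "finite_dim_subspace F"
  shows "\<exists>P M. linear P \<and> range P \<subseteq> F \<and> (\<forall>x\<in>F. P x = x) \<and> 0 \<le> M \<and> (\<forall>x. norm (P x) \<le> M * norm x)"
proof -
  obtain S E where S: "linear S" "finite_dim_subspace E" "range S \<subseteq> E" "\<And>x. norm (S x) \<le> \<kappa> * norm x"
    and close: "\<And>x. x \<in> F \<Longrightarrow> norm (S x - x) \<le> 1 / 2 * norm x"
    using l1_frames_approximation_on_subspace[OF assms, of "1 / 2"] by auto
  have \<kappa>: "0 \<le> \<kappa>" using fr by (simp add: has_l1_frames_def)
  have "x = 0" if "x \<in> F" "S x = 0" for x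
    using close[OF that(1)] that(2) by simp
  then have "inj_on S F"
    using linear_inj_on_iff_eq_0[OF S(1) subspace_finite_dim[OF F]] by blast
  then obtain w where w: "range w \<subseteq> F" "linear w" "\<And>x. x \<in> F \<Longrightarrow> w (S x) = x"
    using real_vector.linear_exists_left_inverse_on[OF S(1)] subspace_finite_dim[OF F]
    by blast
  obtain K where K: "K \<ge> 0" "\<And>x. x \<in> E \<Longrightarrow> norm (w x) \<le> K * norm x"
    using linear_bounded_on_finite_dim[OF fr S(2) w(2)] by blast
  have "norm (w (S x)) \<le> K * \<kappa> * norm x" for x
  proof -
    have "norm (w (S x)) \<le> K * norm (S x)" using S(3) by (intro K(2)) auto
    also have "\<dots> \<le> K * (\<kappa> * norm x)" by (intro mult_left_mono S(4) K(1))
    finally show ?thesis by (simp add: mult.assoc)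
  qed
  moreover have "linear (\<lambda>x. w (S x))"
    using linear_compose[OF S(1) w(2)] by (simp add: o_def)
  ultimately show ?thesis
    using w K(1) \<kappa> by (intro exI[of _ "\<lambda>x. w (S x)"] exI[of _ "K * \<kappa>"]) auto
qed

text \<open>
  The error of an approximation \<open>S\<close> on \<open>F\<close> is removed by passing to \<open>S + (I - S) P\<close> with a bounded
  projection \<open>P\<close> onto \<open>F\<close>. The projection comes first, and \<open>S\<close> is then chosen so accurate on \<open>F\<close>
  that the correction has norm at most one.
\<close>

lemma l1_frames_exact_approximation:
  fixes F :: "'a::real_normed_vector set"
  assumes fr: "has_l1_frames \<kappa> TYPE('a)" and F: "finite_dim_subspace F"
  shows "\<exists>S E. linear S \<and> finite_dim_subspace E \<and> range S \<subseteq> E \<and>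
    (\<forall>x. norm (S x) \<le> (\<kappa> + 1) * norm x) \<and> (\<forall>x\<in>F. S x = x)"
proof -
  obtain P M where P: "linear P" "range P \<subseteq> F" "\<And>x. x \<in> F \<Longrightarrow> P x = x" "0 \<le> M"
    "\<And>x. norm (P x) \<le> M * norm x"
    using l1_frames_bounded_projection[OF assms] by blast
  obtain S E where S: "linear S" "finite_dim_subspace E" "range S \<subseteq> E" "\<And>x. norm (S x) \<le> \<kappa> * norm x"
    and close: "\<And>x. x \<in> F \<Longrightarrow> norm (S x - x) \<le> 1 / (M + 1) * norm x"
    using l1_frames_approximation_on_subspace[OF assms, of "1 / (M + 1)"] P(4) by auto
  obtain E' where E': "finite_dim_subspace E'" "E \<subseteq> E'" "F \<subseteq> E'"
    using finite_dim_subspace_sum[OF S(2) F] by blast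
  define R where "R x = S x - (S (P x) - P x)" for x
  have "linear R"
    unfolding R_def using S(1) P(1)
    by (intro linearI) (simp_all add: linear_add linear_scale algebra_simps)
  moreover have "range R \<subseteq> E'"
  proof -
    have "S x \<in> E'" "S (P x) \<in> E'" "P x \<in> E'" for x
      using S(3) P(2) E' by blast+
    then show ?thesis
      unfolding R_def using subspace_diff[OF subspace_finite_dim[OF E'(1)]] by blast
  qed
  moreover have "norm (R x) \<le> (\<kappa> + 1) * norm x" for x
  proof -
    have "norm (S (P x) - P x) \<le> 1 / (M + 1) * norm (P x)"
      using P(2) by (intro close) auto
    also have "\<dots> \<le> 1 / (M + 1) * (M * norm x)"
      using P(4,5) by (intro mult_left_mono) auto
    also have "\<dots> = M / (M + 1) * norm x" by simp
    also have "\<dots> \<le> 1 * norm x"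
      using P(4) by (intro mult_right_mono) auto
    finally have "norm (S (P x) - P x) \<le> norm x" by simp
    then show ?thesis
      unfolding R_def using S(4)[of x] norm_triangle_ineq4[of "S x" "S (P x) - P x"]
      by (simp add: distrib_right)
  qed
  moreover have "R x = x" if "x \<in> F" for x
    using P(3)[OF that] by (simp add: R_def)
  ultimately show ?thesis using E'(1) by blast
qed

section \<open>Bounded lifts in short exact sequences\<close>

text \<open>
  The Baire category half of the open mapping theorem: the closures of the images of the balls of
  integer radius cover the range, a complete space, so one of them has interior.
\<close>

lemma open_mapping_approximate_preimages:
  fixes T :: "'a::real_normed_vector \<Rightarrow> 'b::banach"
  assumes T: "linear T" and cl: "closed (range T)"
  shows "\<exists>M\<ge>0. \<forall>z\<in>range T. \<exists>x. norm x \<le> M * norm z \<and> norm (z - T x) \<le> norm z / 2"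
proof -
  let ?R = "range T"
  let ?X = "top_of_set ?R"
  define C where "C n = closure (T ` ball 0 (real n)) \<inter> ?R" for n
  have "completely_metrizable_space ?X"
    using cl by (simp add: completely_metrizable_space_closedin completely_metrizable_space_euclidean)
  moreover have "?X interior_of \<Union>(range C) \<noteq> {}"
  proof -
    have "T x \<in> \<Union>(range C)" for x
    proof -
      obtain n where "norm x < real n" using reals_Archimedean2 by blast
      then have "T x \<in> C n" unfolding C_def using closure_subset by force
      then show ?thesis by blast
    qed
    then have "\<Union>(range C) = topspace ?X" by (auto simp: C_def)
    then show ?thesis by (simp only: interior_of_topspace) auto
  qed
  moreover have "closedin ?X (C n)" for n
    unfolding C_def by (auto simp: closedin_closed)
  ultimately obtain n where "?X interior_of C n \<noteq> {}"
    using Baire_category_alt[of ?X "range C"] by (auto simp: countable_image)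
  then obtain y where "y \<in> ?X interior_of C n" by blast
  then obtain U where U: "openin ?X U" "y \<in> U" "U \<subseteq> C n"
    by (auto simp: interior_of_def)
  then obtain V where V: "open V" "U = ?R \<inter> V" by (auto simp: openin_open)
  then obtain r where r: "r > 0" "\<And>u. norm (u - y) < r \<Longrightarrow> u \<in> V"
    using U(2) by (auto simp: open_dist dist_norm)
  have y: "y \<in> ?R" "y \<in> C n" using U V by auto
  have sub: "subspace ?R" using T by (simp add: linear_subspace_image)
  \<comment> \<open>Both \<open>y\<close> and \<open>y + z\<close> are limits of images of the ball of radius \<open>n\<close>; subtract.\<close>
  have approx: "\<exists>x. norm x \<le> 2 * real n \<and> norm (z - T x) < \<epsilon>" if z: "z \<in> ?R" "norm z < r" and \<epsilon>: "\<epsilon> > 0" for z \<epsilon>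
  proof -
    have "y + z \<in> ?R" using sub y z by (intro subspace_add)
    then have "y + z \<in> C n" using U V r(2)[of "y + z"] z(2) by auto
    then have "y + z \<in> closure (T ` ball 0 (real n))" "y \<in> closure (T ` ball 0 (real n))"
      using y by (auto simp: C_def)
    then obtain u v where u: "norm u < real n" "dist (T u) (y + z) < \<epsilon> / 2"
      and v: "norm v < real n" "dist (T v) y < \<epsilon> / 2"
      using \<epsilon> unfolding closure_approachable by (auto dest!: spec[of _ "\<epsilon> / 2"])
    have "norm (u - v) \<le> 2 * real n" using u v norm_triangle_ineq4[of u v] by linarith
    moreover have "norm (z - T (u - v)) < \<epsilon>"
    proof -
      have "z - T (u - v) = (T v - y) - (T u - (y + z))" by (simp add: linear_diff[OF T])
      also have "norm \<dots> \<le> dist (T v) y + dist (T u) (y + z)"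
        unfolding dist_norm by (rule norm_triangle_ineq4)
      finally show ?thesis using u(2) v(2) by linarith
    qed
    ultimately show ?thesis by blast
  qed
  define M where "M = 4 * real n / r"
  have "\<exists>x. norm x \<le> M * norm z \<and> norm (z - T x) \<le> norm z / 2" if z: "z \<in> ?R" for z
  proof (cases "z = 0")
    case True
    then show ?thesis by (intro exI[of _ 0]) (simp add: linear_0[OF T])
  next
    case False
    define t where "t = r / (2 * norm z)"
    have t: "t > 0" using r(1) False by (simp add: t_def)
    have "t *\<^sub>R z \<in> ?R" using sub z by (rule subspace_scale)
    moreover have "norm (t *\<^sub>R z) < r" using t r(1) False by (simp add: t_def)
    ultimately obtain x where x: "norm x \<le> 2 * real n" "norm (t *\<^sub>R z - T x) < t * norm z / 2"
      using approx[of "t *\<^sub>R z" "t * norm z / 2"] t False by auto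
    have "z - T (x /\<^sub>R t) = (t *\<^sub>R z - T x) /\<^sub>R t"
      using t by (simp add: linear_scale[OF T] scaleR_diff_right)
    then have "norm (z - T (x /\<^sub>R t)) = norm (t *\<^sub>R z - T x) / t"
      using t by (simp add: divide_inverse mult.commute)
    also have "\<dots> \<le> norm z / 2" using x(2) t by (simp add: field_simps)
    finally have "norm (z - T (x /\<^sub>R t)) \<le> norm z / 2" .
    moreover have "norm (x /\<^sub>R t) \<le> M * norm z"
    proof -
      have "norm (x /\<^sub>R t) = norm x * (2 * norm z / r)" using t r(1) False by (simp add: t_def field_simps)
      also have "\<dots> \<le> 2 * real n * (2 * norm z / r)" using x(1) r(1) by (intro mult_right_mono) auto
      finally show ?thesis by (simp add: M_def)
    qed
    ultimately show ?thesis by blast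
  qed
  moreover have "M \<ge> 0" using r(1) by (simp add: M_def)
  ultimately show ?thesis by blast
qed

text \<open>
  Successive approximation: the residuals \<open>e k\<close> at least halve in norm at each step, so the
  approximate preimages form an absolutely convergent series. Stating the result for a closed range
  covers both maps of a short exact sequence.
\<close>

lemma open_mapping_closed_range:
  fixes T :: "'a::banach \<Rightarrow> 'b::banach"
  assumes T: "bounded_linear T" and cl: "closed (range T)"
  shows "\<exists>C\<ge>0. \<forall>z\<in>range T. \<exists>x. T x = z \<and> norm x \<le> C * norm z"
proof -
  interpret T: bounded_linear T by fact
  have lin: "linear T" by (rule T.linear_axioms)
  obtain M where M: "M \<ge> 0"
    and ex: "\<And>z. z \<in> range T \<Longrightarrow> \<exists>x. norm x \<le> M * norm z \<and> norm (z - T x) \<le> norm z / 2"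
    using open_mapping_approximate_preimages[OF lin cl] by blast
  have sub: "subspace (range T)" using lin by (simp add: linear_subspace_image)
  obtain p where p: "\<And>z. z \<in> range T \<Longrightarrow> norm (p z) \<le> M * norm z \<and> norm (z - T (p z)) \<le> norm z / 2"
    using ex by metis
  have "\<exists>x. T x = z \<and> norm x \<le> 2 * M * norm z" if z: "z \<in> range T" for z
  proof -
    define e where "e k = ((\<lambda>z. z - T (p z)) ^^ k) z" for k
    have e_Suc: "e (Suc k) = e k - T (p (e k))" for k by (simp add: e_def)
    have e_R: "e k \<in> range T" for k
    proof (induction k)
      case 0 show ?case using z by (simp add: e_def)
    next
      case (Suc k) then show ?case unfolding e_Suc using sub by (intro subspace_diff) auto
    qed
    have e_norm: "norm (e k) \<le> norm z * (1 / 2) ^ k" for k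
    proof (induction k)
      case 0 show ?case by (simp add: e_def)
    next
      case (Suc k) then show ?case using p[OF e_R[of k]] by (simp add: e_Suc)
    qed
    have geo: "(\<lambda>k. M * norm z * (1 / 2) ^ k) sums (2 * M * norm z)"
      using sums_mult[OF geometric_sums[of "1 / 2 :: real"], of "M * norm z"] by (simp add: mult_ac)
    have pe: "norm (p (e k)) \<le> M * norm z * (1 / 2) ^ k" for k
    proof -
      have "norm (p (e k)) \<le> M * norm (e k)" using p[OF e_R] by blast
      also have "\<dots> \<le> M * (norm z * (1 / 2) ^ k)" by (intro mult_left_mono e_norm M)
      finally show ?thesis by (simp add: mult.assoc)
    qed
    have nsum: "summable (\<lambda>k. norm (p (e k)))"
      using pe by (intro summable_comparison_test'[OF sums_summable[OF geo], where N = 0]) simp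
    then have sum: "summable (\<lambda>k. p (e k))" by (rule summable_norm_cancel)
    define x where "x = (\<Sum>k. p (e k))"
    have "norm x \<le> (\<Sum>k. norm (p (e k)))"
      unfolding x_def using nsum by (rule summable_norm)
    also have "\<dots> \<le> (\<Sum>k. M * norm z * (1 / 2) ^ k)"
      by (intro suminf_le pe nsum sums_summable[OF geo])
    also have "\<dots> = 2 * M * norm z" using sums_unique[OF geo] by simp
    finally have "norm x \<le> 2 * M * norm z" .
    moreover have "T x = z"
    proof -
      have "(\<lambda>k. T (p (e k))) sums T x"
        unfolding x_def by (intro T.sums summable_sums sum)
      moreover have "(\<lambda>k. T (p (e k))) sums z"
      proof -
        have "e \<longlonglongrightarrow> 0"
        proof (rule Lim_null_comparison)
          show "\<forall>\<^sub>F k in sequentially. norm (e k) \<le> norm z * (1 / 2) ^ k" using e_norm by simp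
          show "(\<lambda>k. norm z * (1 / 2) ^ k) \<longlonglongrightarrow> 0"
            by (intro tendsto_mult_right_zero LIMSEQ_power_zero) simp
        qed
        from telescope_sums'[OF this] show ?thesis by (simp add: e_Suc e_def)
      qed
      ultimately show ?thesis by (rule sums_unique2)
    qed
    ultimately show ?thesis by blast
  qed
  then show ?thesis using M by (intro exI[of _ "2 * M"]) auto
qed

lemma short_exact_bounded_lifts:
  assumes "short_exact j q"
  shows "\<exists>C\<ge>0. \<forall>z. \<exists>x. q x = z \<and> norm x \<le> C * norm z"
  using open_mapping_closed_range[of q] assms unfolding short_exact_def by auto

lemma short_exact_left_inverse:
  assumes "short_exact j q"
  shows "\<exists>g C. linear g \<and> 0 \<le> C \<and> (\<forall>y. g (j y) = y) \<and> (\<forall>y. norm y \<le> C * norm (j y))"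
proof -
  have j: "bounded_linear j" and inj: "{y. j y = 0} = {0}" and ran: "{x. q x = 0} = range j"
    and q: "bounded_linear q" using assms by (auto simp: short_exact_def)
  have lin: "linear j" using j by (simp add: bounded_linear.linear)
  have "closed {x. q x = 0}"
    using bounded_linear.continuous_on[OF q continuous_on_id] by (intro closed_Collect_eq) auto
  then obtain C where C: "C \<ge> 0" "\<And>z. z \<in> range j \<Longrightarrow> \<exists>x. j x = z \<and> norm x \<le> C * norm z"
    using open_mapping_closed_range[OF j] ran by auto
  have inj': "inj j" using lin inj by (auto simp: linear_injective_0)
  obtain g where g: "linear g" "g \<circ> j = id"
    using linear_injective_left_inverse[OF lin inj'] by blast
  have "norm y \<le> C * norm (j y)" for y
    using C(2)[of "j y"] injD[OF inj'] by auto
  moreover have "g (j y) = y" for y using g(2) by (metis comp_apply id_apply)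
  ultimately show ?thesis using g(1) C(1) by blast
qed

text \<open>
  Lifting property of \<open>\<ell>\<^sub>1\<close>: send each frame vector \<open>g\<^sub>i\<close> to a preimage \<open>l\<^sub>i\<close> of \<open>q' g\<^sub>i\<close> under \<open>q\<close>. The bound
  does not depend on the dimension of \<open>F\<close>.
\<close>

lemma l1_frame_lifting:
  fixes q :: "'a::real_normed_vector \<Rightarrow> 'z::real_normed_vector" and q' :: "'b::real_normed_vector \<Rightarrow> 'z"
  assumes fr: "has_l1_frames \<kappa> TYPE('b)" and F: "finite_dim_subspace F"
    and q: "linear q" "\<And>z. \<exists>x. q x = z \<and> norm x \<le> C * norm z" "0 \<le> C"
    and q': "linear q'" "\<And>x. norm (q' x) \<le> K * norm x" "0 \<le> K"
  shows "\<exists>\<Phi>. linear \<Phi> \<and> (\<forall>x\<in>F. q (\<Phi> x) = q' x \<and> norm (\<Phi> x) \<le> C * K * \<kappa> * norm x)"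
proof -
  obtain n g a where fra: "l1_frame \<kappa> F n g a"
    using fr F unfolding has_l1_frames_def by blast
  define l where "l i = (SOME x. q x = q' (g i) \<and> norm x \<le> C * norm (q' (g i)))" for i
  have l: "q (l i) = q' (g i)" "norm (l i) \<le> C * norm (q' (g i))" for i
    unfolding l_def using someI_ex[OF q(2)[of "q' (g i)"]] by auto
  have l_bound: "norm (l i) \<le> C * K" if "i < n" for i
  proof -
    have "norm (q' (g i)) \<le> K * norm (g i)" by (rule q')
    also have "\<dots> \<le> K * 1" using fra that q'(3) by (intro mult_left_mono) (auto simp: l1_frame_def)
    finally have "C * norm (q' (g i)) \<le> C * (K * 1)" using q(3) by (intro mult_left_mono)
    then show ?thesis using l(2)[of i] by simp
  qed
  define \<Phi> where "\<Phi> x = (\<Sum>i<n. a i x *\<^sub>R l i)" for x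
  have lin_a: "linear (a i)" for i using fra by (simp add: l1_frame_def)
  have "linear \<Phi>"
    unfolding \<Phi>_def
    by (rule linearI) (simp_all add: linear_add[OF lin_a] linear_scale[OF lin_a] scaleR_add_left
        sum.distrib scaleR_sum_right)
  moreover have "q (\<Phi> x) = q' x" "norm (\<Phi> x) \<le> C * K * \<kappa> * norm x" if x: "x \<in> F" for x
  proof -
    have exp: "(\<Sum>i<n. a i x *\<^sub>R g i) = x" and bd: "(\<Sum>i<n. \<bar>a i x\<bar>) \<le> \<kappa> * norm x"
      using fra x by (auto simp: l1_frame_def)
    have "q (\<Phi> x) = q' (\<Sum>i<n. a i x *\<^sub>R g i)"
      by (simp add: \<Phi>_def linear_sum[OF q(1)] linear_sum[OF q'(1)] linear_scale[OF q(1)]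
          linear_scale[OF q'(1)] l(1))
    then show "q (\<Phi> x) = q' x" by (simp add: exp)
    have "norm (\<Phi> x) \<le> (\<Sum>i<n. \<bar>a i x\<bar> * (C * K))"
      unfolding \<Phi>_def by (intro sum_norm_le) (auto intro!: mult_left_mono l_bound)
    also have "\<dots> = (C * K) * (\<Sum>i<n. \<bar>a i x\<bar>)" by (simp add: sum_distrib_right[symmetric])
    also have "\<dots> \<le> (C * K) * (\<kappa> * norm x)" using q(3) q'(3) by (intro mult_left_mono bd) auto
    finally show "norm (\<Phi> x) \<le> C * K * \<kappa> * norm x" by (simp add: mult.assoc)
  qed
  ultimately show ?thesis by blast
qed

section \<open>Transfer of the approximation property\<close>

text \<open>
  A global substitute for the map \<open>y \<mapsto> U (W y + \<Phi> (D y))\<close>, where \<open>\<Phi>\<close> would be a lift of \<open>q'\<close> through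
  \<open>q\<close> defined on the whole space. Such a lift may not exist, but there are uniformly bounded lifts
  on finite dimensional subspaces. Since \<open>U\<close> has finite rank, its composites with these local lifts
  take values in bounded subsets of one finite dimensional space and hence accumulate. The relation
  between \<open>W\<close> and \<open>D\<close> says that \<open>W y + \<Phi> (D y)\<close> lies in the kernel of \<open>q\<close>, where \<open>U\<close> is bounded.
\<close>

lemma finite_rank_composite_with_lifts:
  fixes q :: "'a::real_normed_vector \<Rightarrow> 'z::real_normed_vector" and q' :: "'b::real_normed_vector \<Rightarrow> 'z"
    and W :: "'y::real_normed_vector \<Rightarrow> 'a" and D :: "'y \<Rightarrow> 'b"
  assumes fr: "has_l1_frames \<kappa> TYPE('a)" and q: "bounded_linear q"
    and lifts: "\<And>F :: 'b set. finite_dim_subspace F \<Longrightarrow>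
      \<exists>\<Phi>. linear \<Phi> \<and> (\<forall>x\<in>F. q (\<Phi> x) = q' x \<and> norm (\<Phi> x) \<le> c * norm x)"
    and W: "linear W" and D: "linear D" and WD: "\<And>y. q (W y) + q' (D y) = 0"
    and U: "linear U" "finite_dim_subspace E" "range U \<subseteq> E" "\<And>x. q (U x) = 0"
      "\<And>x. q x = 0 \<Longrightarrow> norm (U x) \<le> u * norm x"
    and pos: "0 \<le> u" "0 \<le> c"
  shows "\<exists>V E'. linear V \<and> finite_dim_subspace E' \<and> range V \<subseteq> E' \<and> (\<forall>y. q (V y) = 0) \<and>
    (\<forall>y. norm (V y) \<le> u * (norm (W y) + c * norm (D y))) \<and> (\<forall>y. D y = 0 \<longrightarrow> V y = U (W y))"
proof -
  have linq: "linear q" using q by (rule bounded_linear.linear)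
  have "\<exists>\<Phi>. linear \<Phi> \<and> (\<forall>x\<in>span s. q (\<Phi> x) = q' x \<and> norm (\<Phi> x) \<le> c * norm x)" if "finite s" for s
    using lifts[OF finite_dim_subspace_span[OF that]] .
  then obtain \<Phi> where lin: "\<And>s. finite s \<Longrightarrow> linear (\<Phi> s)"
    and lift: "\<And>s x. finite s \<Longrightarrow> x \<in> span s \<Longrightarrow> q (\<Phi> s x) = q' x"
    and bd: "\<And>s x. finite s \<Longrightarrow> x \<in> span s \<Longrightarrow> norm (\<Phi> s x) \<le> c * norm x"
    by metis
  define h where "h s y = (if finite s \<and> D y \<in> span s then U (W y + \<Phi> s (D y)) else 0)" for s y
  let ?b = "\<lambda>y. u * (norm (W y) + c * norm (D y))"
  have h_bd: "norm (h s y) \<le> ?b y" for s y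
  proof (cases "finite s \<and> D y \<in> span s")
    case True
    have "q (W y + \<Phi> s (D y)) = 0"
      using True WD[of y] by (simp add: linear_add[OF linq] lift)
    then have "norm (h s y) \<le> u * norm (W y + \<Phi> s (D y))"
      using U(5) True by (simp add: h_def)
    also have "\<dots> \<le> ?b y"
      using True bd[of s "D y"] pos by (intro mult_left_mono norm_triangle_mono) auto
    finally show ?thesis .
  next
    case False
    then show ?thesis using pos by (auto simp: h_def)
  qed
  have h_E: "h s y \<in> E" for s y
    using U(3) subspace_0[OF subspace_finite_dim[OF U(2)]] by (auto simp: h_def)
  have qh: "q (h s y) = 0" for s y
    using U(4) linear_0[OF linq] by (auto simp: h_def)
  obtain F' V E' where F': "F' \<le> finite_subsets_at_top UNIV" "F' \<noteq> bot"
    and V: "\<And>y. ((\<lambda>s. h s y) \<longlongrightarrow> V y) F'" and E': "finite_dim_subspace E'" "range V \<subseteq> E'"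
    using bounded_finite_dim_net_subnet[OF fr U(2) finite_subsets_at_top_neq_bot[of UNIV], of h ?b] h_E h_bd
    by blast
  have ev: "\<forall>\<^sub>F s in F'. finite s \<and> x \<in> span s" for x
    using filter_leD[OF F'(1) eventually_span_union[of x "{}"]] by simp
  have "linear V"
  proof (rule linearI)
    fix x y :: 'y and r :: real
    have "((\<lambda>s. h s x + h s y) \<longlongrightarrow> V (x + y)) F'"
      using V[of "x + y"]
    proof (rule Lim_transform_eventually)
      show "\<forall>\<^sub>F s in F'. h s (x + y) = h s x + h s y"
        using ev[of "D x"] ev[of "D y"]
      proof eventually_elim
        case (elim s)
        then have "W (x + y) + \<Phi> s (D (x + y)) = (W x + \<Phi> s (D x)) + (W y + \<Phi> s (D y))"
          by (simp add: linear_add[OF W] linear_add[OF D] linear_add[OF lin])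
        then show ?case using elim
          by (simp add: h_def linear_add[OF D] span_add linear_add[OF U(1)])
      qed
    qed
    then show "V (x + y) = V x + V y"
      by (rule tendsto_unique[OF F'(2)]) (intro tendsto_intros V)
    have "((\<lambda>s. r *\<^sub>R h s x) \<longlongrightarrow> V (r *\<^sub>R x)) F'"
      using V[of "r *\<^sub>R x"]
    proof (rule Lim_transform_eventually)
      show "\<forall>\<^sub>F s in F'. h s (r *\<^sub>R x) = r *\<^sub>R h s x"
        using ev[of "D x"]
      proof eventually_elim
        case (elim s)
        then have "W (r *\<^sub>R x) + \<Phi> s (D (r *\<^sub>R x)) = r *\<^sub>R (W x + \<Phi> s (D x))"
          by (simp add: linear_scale[OF W] linear_scale[OF D] linear_scale[OF lin] scaleR_add_right)
        then show ?case using elim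
          by (simp add: h_def linear_scale[OF D] span_scale linear_scale[OF U(1)])
      qed
    qed
    then show "V (r *\<^sub>R x) = r *\<^sub>R V x"
      by (rule tendsto_unique[OF F'(2)]) (intro tendsto_intros V)
  qed
  moreover have "q (V y) = 0" for y
    using tendsto_unique[OF F'(2) bounded_linear.tendsto[OF q V[of y]], of 0] by (simp add: qh)
  moreover have "norm (V y) \<le> ?b y" for y
    using tendsto_upperbound[OF tendsto_norm[OF V[of y]] _ F'(2), of "?b y"] h_bd by simp
  moreover have "V y = U (W y)" if "D y = 0" for y
  proof (rule tendsto_unique[OF F'(2) V[of y]])
    have "\<forall>\<^sub>F s in F'. U (W y) = h s y"
      using ev[of 0] by eventually_elim (simp add: h_def that linear_0[OF lin])
    then show "((\<lambda>s. h s y) \<longlongrightarrow> U (W y)) F'"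
      by (rule Lim_transform_eventually[OF tendsto_const])
  qed
  ultimately show ?thesis using E' by blast
qed

text \<open>
  With \<open>S\<close> a finite rank operator fixing \<open>j' ` F\<close>, a lift \<open>\<Phi>\<close> of \<open>q'\<close> on the range of \<open>S\<close>, and \<open>U\<close> the
  operator on the kernel of \<open>q\<close> given by the approximation property, the operator is
  \<open>Q = S - \<Psi> \<Phi> S + \<Psi> V\<close>, preceded by \<open>j'\<close> and followed by its inverse. Here \<open>V\<close> is the substitute
  for \<open>U (\<Phi> S + \<Phi>' (I - S))\<close> with local lifts \<open>\<Phi>'\<close>, and \<open>\<Psi>\<close> lifts \<open>q\<close> through \<open>q'\<close> on a finite
  dimensional space containing the ranges of \<open>\<Phi> S\<close> and \<open>V\<close>.
\<close>

lemma BAP_transfer_between_kernels: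
  fixes j :: "'y::banach \<Rightarrow> 'l::banach" and q :: "'l \<Rightarrow> 'z::banach"
    and j' :: "'y2::banach \<Rightarrow> 'l2::banach" and q' :: "'l2 \<Rightarrow> 'z"
  assumes fr: "has_l1_frames \<kappa> TYPE('l)" and fr': "has_l1_frames \<kappa>' TYPE('l2)"
    and se: "short_exact j q" and se': "short_exact j' q'"
    and bap: "lambda_BAP \<beta> TYPE('y)"
  shows "has_BAP TYPE('y2)"
proof -
  have bl: "bounded_linear j" "bounded_linear q" "bounded_linear j'" "bounded_linear q'"
    using se se' by (auto simp: short_exact_def)
  note lin = bl[THEN bounded_linear.linear]
  have qj: "q x = 0 \<longleftrightarrow> x \<in> range j" for x using se unfolding short_exact_def by blast
  have qj': "q' x = 0 \<longleftrightarrow> x \<in> range j'" for x using se' unfolding short_exact_def by blast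
  have \<kappa>: "0 \<le> \<kappa>" "0 \<le> \<kappa>'" using fr fr' by (auto simp: has_l1_frames_def)
  have \<beta>: "1 \<le> \<beta>" using bap by (simp add: lambda_BAP_def)
  obtain J where J: "0 \<le> J" "\<And>x. norm (j x) \<le> norm x * J"
    using bounded_linear.nonneg_bounded[OF bl(1)] by blast
  obtain J' where J': "0 \<le> J'" "\<And>x. norm (j' x) \<le> norm x * J'"
    using bounded_linear.nonneg_bounded[OF bl(3)] by blast
  obtain K where K: "0 \<le> K" "\<And>x. norm (q x) \<le> norm x * K"
    using bounded_linear.nonneg_bounded[OF bl(2)] by blast
  obtain K' where K': "0 \<le> K'" "\<And>x. norm (q' x) \<le> norm x * K'"
    using bounded_linear.nonneg_bounded[OF bl(4)] by blast
  obtain C where C: "0 \<le> C" "\<And>z. \<exists>x. q x = z \<and> norm x \<le> C * norm z"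
    using short_exact_bounded_lifts[OF se] by blast
  obtain C' where C': "0 \<le> C'" "\<And>z. \<exists>x. q' x = z \<and> norm x \<le> C' * norm z"
    using short_exact_bounded_lifts[OF se'] by blast
  obtain g A where g: "linear g" "0 \<le> A" "\<And>y. g (j y) = y" "\<And>y. norm y \<le> A * norm (j y)"
    using short_exact_left_inverse[OF se] by blast
  obtain g' A' where g': "linear g'" "0 \<le> A'" "\<And>y. g' (j' y) = y" "\<And>y. norm y \<le> A' * norm (j' y)"
    using short_exact_left_inverse[OF se'] by blast
  define c where "c = C * K' * \<kappa>'"
  define c' where "c' = C' * K * \<kappa>"
  define \<sigma> where "\<sigma> = \<kappa>' + 1"
  define u where "u = J * \<beta> * A"
  have nonneg: "0 \<le> c" "0 \<le> c'" "0 \<le> \<sigma>" "0 \<le> u"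
    using C C' K K' \<kappa> \<beta> J g by (auto simp: c_def c'_def \<sigma>_def u_def)
  have lift: "\<exists>\<Phi>. linear \<Phi> \<and> (\<forall>x\<in>F. q (\<Phi> x) = q' x \<and> norm (\<Phi> x) \<le> c * norm x)"
    if "finite_dim_subspace F" for F
    unfolding c_def using l1_frame_lifting[OF fr' that lin(2) C(2) C(1) lin(4) _ K'(1)] K'(2)
    by (simp add: mult.commute)
  have lift': "\<exists>\<Psi>. linear \<Psi> \<and> (\<forall>x\<in>F. q' (\<Psi> x) = q x \<and> norm (\<Psi> x) \<le> c' * norm x)"
    if "finite_dim_subspace F" for F
    unfolding c'_def using l1_frame_lifting[OF fr that lin(4) C'(2) C'(1) lin(2) _ K(1)] K(2)
    by (simp add: mult.commute)
  \<comment> \<open>\<open>B\<close> involves only constants of the spaces and maps, so it serves all subspaces \<open>F\<close>.\<close>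
  define B where "B = A' * (\<sigma> + c' * (c * \<sigma>) + c' * (u * (c * \<sigma> + c * (1 + \<sigma>)))) * J'"
  have "\<exists>R. bounded_linear R \<and> finite_dim_subspace (range R) \<and> onorm R \<le> max 1 B \<and> (\<forall>f\<in>F. R f = f)"
    if F: "finite_dim_subspace F" for F :: "'y2 set"
  proof -
    have F1: "finite_dim_subspace (j' ` F)" using lin(3) F by (rule finite_dim_subspace_image)
    obtain S E where S: "linear S" "finite_dim_subspace E" "range S \<subseteq> E"
      "\<And>x. norm (S x) \<le> \<sigma> * norm x" "\<And>x. x \<in> j' ` F \<Longrightarrow> S x = x"
      using l1_frames_exact_approximation[OF fr' F1] unfolding \<sigma>_def by blast
    have SE: "S x \<in> E" for x using S(3) by blast
    obtain \<Phi> where \<Phi>: "linear \<Phi>" "\<And>x. x \<in> E \<Longrightarrow> q (\<Phi> x) = q' x" "\<And>x. x \<in> E \<Longrightarrow> norm (\<Phi> x) \<le> c * norm x"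
      using lift[OF S(2)] by blast
    \<comment> \<open>\<open>\<Phi>\<close> maps \<open>j' ` F\<close> into the kernel of \<open>q\<close>, where \<open>g\<close> inverts \<open>j\<close>.\<close>
    define Fy where "Fy = g ` \<Phi> ` j' ` F"
    have "finite_dim_subspace Fy"
      unfolding Fy_def
      by (rule finite_dim_subspace_image[OF g(1) finite_dim_subspace_image[OF \<Phi>(1) F1]])
    then obtain T :: "'y \<Rightarrow> 'y" where T: "bounded_linear T" "finite_dim_subspace (range T)" "onorm T \<le> \<beta>"
      "\<And>f. f \<in> Fy \<Longrightarrow> T f = f"
      using bap unfolding lambda_BAP_def by blast
    define U where "U x = j (T (g x))" for x
    define W where "W y = \<Phi> (S (j' y))" for y
    define D where "D y = j' y - S (j' y)" for y
    have linU: "linear U"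
      unfolding U_def using linear_compose[OF linear_compose[OF g(1) bounded_linear.linear[OF T(1)]] lin(1)]
      by (simp add: o_def)
    have U_bd: "norm (U x) \<le> u * norm x" if x: "q x = 0" for x
    proof -
      obtain y where y: "x = j y" using x qj by blast
      have "norm (T y) \<le> onorm T * norm y" using T(1) by (rule onorm)
      also have "\<dots> \<le> \<beta> * (A * norm x)"
        using T(3) g(2,4) \<beta> unfolding y by (intro mult_mono) auto
      finally have "norm (T y) * J \<le> \<beta> * (A * norm x) * J"
        using J(1) by (rule mult_right_mono)
      moreover have "norm (U x) \<le> norm (T y) * J" unfolding U_def y g(3) by (rule J(2))
      ultimately show ?thesis by (simp add: u_def mult_ac)
    qed
    have linW: "linear W"
      unfolding W_def using linear_compose[OF linear_compose[OF lin(3) S(1)] \<Phi>(1)] by (simp add: o_def)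
    have linD: "linear D"
      unfolding D_def using linear_compose_sub[OF lin(3) linear_compose[OF lin(3) S(1)]] by (simp add: o_def)
    have WD: "q (W y) + q' (D y) = 0" for y
    proof -
      have "q' (j' y) = 0" using qj' by blast
      then show ?thesis unfolding W_def D_def using \<Phi>(2)[OF SE] by (simp add: linear_diff[OF lin(4)])
    qed
    obtain V E' where V: "linear V" "finite_dim_subspace E'" "range V \<subseteq> E'" "\<And>y. q (V y) = 0"
      "\<And>y. norm (V y) \<le> u * (norm (W y) + c * norm (D y))" "\<And>y. D y = 0 \<Longrightarrow> V y = U (W y)"
    proof -
      have jT: "finite_dim_subspace (j ` range T)" using lin(1) T(2) by (rule finite_dim_subspace_image)
      have Uj: "range U \<subseteq> j ` range T" unfolding U_def by blast
      have qU: "q (U x) = 0" for x unfolding U_def qj by blast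
      have "\<exists>V E'. linear V \<and> finite_dim_subspace E' \<and> range V \<subseteq> E' \<and> (\<forall>y. q (V y) = 0) \<and>
          (\<forall>y. norm (V y) \<le> u * (norm (W y) + c * norm (D y))) \<and> (\<forall>y. D y = 0 \<longrightarrow> V y = U (W y))"
        by (rule finite_rank_composite_with_lifts[OF fr bl(2) lift linW linD WD linU jT Uj qU U_bd nonneg(4,1)])
      then show ?thesis
        by (elim exE conjE) (rule that, assumption, assumption, assumption, simp_all)
    qed
    obtain E1 where E1: "finite_dim_subspace E1" "\<Phi> ` E \<subseteq> E1" "E' \<subseteq> E1"
      using finite_dim_subspace_sum[OF finite_dim_subspace_image[OF \<Phi>(1) S(2)] V(2)] by blast
    have WE1: "W y \<in> E1" and VE1: "V y \<in> E1" for y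
      using E1 SE V(3) unfolding W_def by blast+
    obtain \<Psi> where \<Psi>: "linear \<Psi>" "\<And>x. x \<in> E1 \<Longrightarrow> q' (\<Psi> x) = q x" "\<And>x. x \<in> E1 \<Longrightarrow> norm (\<Psi> x) \<le> c' * norm x"
      using lift'[OF E1(1)] by blast
    \<comment> \<open>In \<open>q' (Q y)\<close> the first two terms cancel, as \<open>\<Psi>\<close> and \<open>\<Phi>\<close> are lifts, and \<open>q (V y) = 0\<close>.\<close>
    define Q where "Q y = S (j' y) - \<Psi> (W y) + \<Psi> (V y)" for y
    have "q' (Q y) = 0" for y
      unfolding Q_def using \<Psi>(2)[OF WE1] \<Psi>(2)[OF VE1] V(4) \<Phi>(2)[OF SE]
      by (simp add: linear_add[OF lin(4)] linear_diff[OF lin(4)] W_def)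
    then have Q_range: "Q y \<in> range j'" for y using qj' by blast
    have linQ: "linear Q"
      unfolding Q_def
      using linear_compose_add[OF linear_compose_sub[OF linear_compose[OF lin(3) S(1)] linear_compose[OF linW \<Psi>(1)]]
          linear_compose[OF V(1) \<Psi>(1)]]
      by (simp add: o_def)
    define R where "R y = g' (Q y)" for y
    have jR: "j' (R y) = Q y" for y
      using Q_range[of y] g'(3) unfolding R_def by auto
    have linR: "linear R" unfolding R_def using linear_compose[OF linQ g'(1)] by (simp add: o_def)
    have R_bd: "norm (R y) \<le> B * norm y" for y
    proof -
      let ?n = "norm (j' y)"
      have nS: "norm (S (j' y)) \<le> \<sigma> * ?n" by (rule S(4))
      have nW: "norm (W y) \<le> c * (\<sigma> * ?n)"
        unfolding W_def using \<Phi>(3)[OF SE] mult_left_mono[OF nS nonneg(1)] by (rule order_trans)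
      have nD: "norm (D y) \<le> (1 + \<sigma>) * ?n"
        unfolding D_def using norm_triangle_ineq4[of "j' y" "S (j' y)"] nS by (simp add: distrib_right)
      have nV: "norm (V y) \<le> u * (c * (\<sigma> * ?n) + c * ((1 + \<sigma>) * ?n))"
        using V(5)[of y] mult_left_mono[OF add_mono[OF nW mult_left_mono[OF nD nonneg(1)]] nonneg(4)]
        by (rule order_trans)
      have "norm (Q y) \<le> norm (S (j' y)) + norm (\<Psi> (W y)) + norm (\<Psi> (V y))"
        unfolding Q_def by (intro norm_triangle_mono norm_triangle_ineq4 order_refl)
      also have "\<dots> \<le> \<sigma> * ?n + c' * (c * (\<sigma> * ?n)) + c' * (u * (c * (\<sigma> * ?n) + c * ((1 + \<sigma>) * ?n)))"
        using order_trans[OF \<Psi>(3)[OF WE1] mult_left_mono[OF nW nonneg(2)]]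
          order_trans[OF \<Psi>(3)[OF VE1] mult_left_mono[OF nV nonneg(2)]] nS
        by (intro add_mono)
      also have "\<dots> = (\<sigma> + c' * (c * \<sigma>) + c' * (u * (c * \<sigma> + c * (1 + \<sigma>)))) * ?n"
        by (simp add: algebra_simps)
      also have "\<dots> \<le> (\<sigma> + c' * (c * \<sigma>) + c' * (u * (c * \<sigma> + c * (1 + \<sigma>)))) * (norm y * J')"
        using nonneg by (intro mult_left_mono J'(2)) simp
      finally have "A' * norm (Q y) \<le> A' * \<dots>" using g'(2) by (rule mult_left_mono)
      moreover have "norm (R y) \<le> A' * norm (Q y)" using g'(4)[of "R y"] by (simp add: jR)
      ultimately show ?thesis unfolding B_def by (simp add: mult_ac)
    qed
    have "bounded_linear R"
      using linR R_bd by (intro bounded_linear.intro bounded_linear_axioms.intro)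
        (auto simp: mult.commute)
    moreover have "finite_dim_subspace (range R)"
    proof -
      obtain E2 where E2: "finite_dim_subspace E2" "E \<subseteq> E2" "\<Psi> ` E1 \<subseteq> E2"
        using finite_dim_subspace_sum[OF S(2) finite_dim_subspace_image[OF \<Psi>(1) E1(1)]] by blast
      have "Q y \<in> E2" for y
      proof -
        have "S (j' y) \<in> E2" "\<Psi> (W y) \<in> E2" "\<Psi> (V y) \<in> E2"
          using E2 SE WE1 VE1 by blast+
        then show ?thesis
          unfolding Q_def using subspace_finite_dim[OF E2(1)] by (intro subspace_add subspace_diff)
      qed
      then have "range R \<subseteq> g' ` E2" unfolding R_def by blast
      then show ?thesis
        using finite_dim_subspace_mono[OF finite_dim_subspace_image[OF g'(1) E2(1)]]
          linear_subspace_image[OF linR subspace_UNIV] by blast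
    qed
    moreover have "onorm R \<le> max 1 B"
    proof (rule onorm_bound)
      show "0 \<le> max 1 B" by simp
      fix y :: 'y2
      have "B * norm y \<le> max 1 B * norm y" by (intro mult_right_mono) auto
      then show "norm (R y) \<le> max 1 B * norm y" using R_bd[of y] by linarith
    qed
    moreover have "R f = f" if f: "f \<in> F" for f
    proof -
      have Sf: "S (j' f) = j' f" using f by (intro S(5)) auto
      then have "D f = 0" by (simp add: D_def)
      then have "V f = U (W f)" by (rule V(6))
      also have "\<dots> = W f"
      proof -
        have "q (W f) = 0" using WD[of f] \<open>D f = 0\<close> linear_0[OF lin(4)] by simp
        then obtain y where y: "W f = j y" using qj by blast
        have "T (g (W f)) = g (W f)" unfolding W_def Sf using f by (intro T(4)) (auto simp: Fy_def)
        then show ?thesis unfolding U_def y g(3) by simp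
      qed
      finally have "Q f = j' f" by (simp add: Q_def Sf)
      then show ?thesis by (simp add: R_def g'(3))
    qed
    ultimately show ?thesis by blast
  qed
  then have "lambda_BAP (max 1 B) TYPE('y2)" unfolding lambda_BAP_def by simp
  then show ?thesis unfolding has_BAP_def by blast
qed

theorem proposition2p1:
  fixes j :: "'y::banach \<Rightarrow> 'l::banach" and q :: "'l \<Rightarrow> 'z::banach"
    and j' :: "'y2::banach \<Rightarrow> 'l2::banach" and q' :: "'l2 \<Rightarrow> 'z"
  assumes "script_L1_space TYPE('l)" and "script_L1_space TYPE('l2)"
    and "short_exact j q" and "short_exact j' q'"
  shows "has_BAP TYPE('y) \<longleftrightarrow> has_BAP TYPE('y2)"
proof -
  obtain \<kappa> \<kappa>' where fr: "has_l1_frames \<kappa> TYPE('l)" and fr': "has_l1_frames \<kappa>' TYPE('l2)"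
    using script_L1_space_has_l1_frames[OF assms(1)] script_L1_space_has_l1_frames[OF assms(2)] by blast
  show ?thesis
    using BAP_transfer_between_kernels[OF fr fr' assms(3,4)] BAP_transfer_between_kernels[OF fr' fr assms(4,3)]
    unfolding has_BAP_def by blast
qed

end
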